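(* In the $GL_q(N)$ differential algebra generated by the entries of the $N\times N$ matrices $T$, $\omega$, $L$, $L^{-1}$, $J$ with the relations given in the context, the element $$Q^*=\mathrm{Tr}_q\Big(J\,\frac{L^{-1}-\mathbf 1}{\lambda}+J\,L^{-1}J\,\omega\Big)=\frac1\lambda\Big(\mathrm{Tr}_q(\Theta^* )-\mathrm{Tr}_q(J)\Big),\qquad \Theta^*=J\,L^{-1}(\mathbf 1+\lambda J\omega)$$ (the anti-BRST operator for $U_q(gl(N))$) satisfies $$(Q^* )^2=0,\qquad [Q^*,L]=0,\qquad [Q^*,T]=q^{2N}\,T\,J,\qquad [Q^*,J]_+=-q^{2N}J^2,$$ $$[Q^*,\omega]_+=q^{2N}\Big(W\,\frac{\mathbf 1-L^{-1}}{\lambda}\,\overline W-\lambda\,\omega\,J^2\,\omega\Big),\qquad W=\mathbf 1+\lambda\,\omega J,\quad \overline W=\mathbf 1+\lambda\,J\omega.$$ Here $[Q^*,Y]$ and $[Q^*,Y]_+$ for a matrix $Y$ denote the matrices of entrywise commutators and anticommutators, and all products of matrices are matrix products.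
   Context: Notation. $q$ is the deformation parameter, $\lambda=q-q^{-1}\ne0$. $\hat R=P_{12}R_{12}$, where $P_{12}$ is the permutation matrix on $\mathbb C^N\otimes\mathbb C^N$ and $R_{12}$ is the $GL_q(N)$ Drinfeld–Jimbo matrix $$R^{i_1i_2}_{j_1j_2}=\delta^{i_1}_{j_1}\delta^{i_2}_{j_2}\big(1+(q-1)\delta^{i_1i_2}\big)+(q-q^{-1})\delta^{i_1}_{j_2}\delta^{i_2}_{j_1}\Theta_{i_1i_2},$$ with $\Theta_{ij}=1$ for $i>j$ and $0$ for $i\le j$; it satisfies $\hat R^2=\lambda\hat R+\mathbf 1$. For an $N\times N$ matrix $Y$ (possibly with noncommuting entries), $Y_1=Y\otimes\mathbf 1$, $Y_2=\mathbf 1\otimes Y$, and the quantum trace is $\mathrm{Tr}_q(Y)=\mathrm{Tr}(D^{-1}Y)$ with $(D^{-1})^i_j=q^{2(N-i)+1}\delta^i_j$. The Hopf algebra $U_q(gl(N))$ is generated by the entries of an upper triangular matrix $L^+$ and a lower triangular matrix $L^-$ with $(L^+)^i_i(L^-)^i_i=1$ for all $i$, with relations $\hat R L^\pm_2L^\pm_1=L^\pm_2L^\pm_1\hat R$, $\hat R L^+_2L^-_1=L^-_2L^+_1\hat R$ and antipode $S(L^\pm)=(L^\pm)^{-1}$. The $GL_q(N)$ differential algebra is the associative unital algebra generated by the entries of the $N\times N$ matrices $T$ (generators of the quantum group $Fun(GL_q(N))$), $\omega$ (1-forms), $L$ (with inverse $L^{-1}$; $L^i_j=(L^+)^i_kS((L^-)^k_j)$)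 and $J$ (inner derivatives), with relations $$\omega_2\hat R^{-1}\omega_2\hat R=-\hat R^{-1}\omega_2\hat R^{-1}\omega_2,\quad \omega_2\hat RL_2\hat R=\hat RL_2\hat R\omega_2,$$ $$\omega_2\hat RJ_2\hat R+\hat RJ_2\hat R\omega_2=-\hat R,\quad L_2\hat RL_2\hat R=\hat RL_2\hat RL_2,$$ $$J_2\hat RL_2\hat R=\hat RL_2\hat RJ_2,\quad J_2\hat RJ_2\hat R=-\hat R^{-1}J_2\hat RJ_2,$$ $$\hat RT_1T_2=T_1T_2\hat R,\quad \omega_1T_2=T_2\hat R^{-1}\omega_2\hat R^{-1},\quad J_1T_2=T_2\hat RJ_2\hat R,\quad L_1T_2=T_2\hat RL_2\hat R.$$
   Formalization: The printed signs of two formulas are wrong (see N=1) and are corrected to [Q*,T] = -q^{2N} T J and [Q*,J]_+ = +q^{2N} J^2; the case q^2 = -1 is excluded, since (Q* )^2 = 0 fails there for N=1. *)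

theory Defs
  imports "HOL-Analysis.Analysis" "HOL-Library.Poly_Mapping"
begin

text \<open>
  Conventions.  The row/column indices \<open>1, ..., N\<close> are the elements of a finite linearly ordered
  type \<open>'n\<close>, in increasing order, so \<open>N = CARD('n)\<close>; \<open>A $ i $ j\<close> is the entry with upper
  (row) index \<open>i\<close> and lower (column) index \<open>j\<close>, and matrices on
  \<open>V \<otimes> V\<close> are indexed by pairs.  The differential algebra is the quotient of the free algebra
  on the entries of \<open>T\<close>, \<open>\<omega>\<close>, \<open>L\<close>, \<open>L\<^sup>-\<^sup>1\<close>, \<open>J\<close> by the two-sided ideal generated by the defining
  relations; equality in it is written as congruence modulo that ideal.
\<close>

section \<open>Free algebras and two-sided ideals\<close>

datatype 'g fword = Word (letters: "'g list")

instantiation fword :: (type) monoid_add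
begin
definition zero_fword :: "'a fword" where "zero_fword = Word []"
definition plus_fword :: "'a fword \<Rightarrow> 'a fword \<Rightarrow> 'a fword"
  where "plus_fword u v = Word (letters u @ letters v)"
instance by standard (simp_all add: zero_fword_def plus_fword_def)
end

text \<open>As the monoid of words is written additively, \<open>'g free_alg\<close> is its monoid algebra over
  the complex numbers, with the convolution product of \<^theory>\<open>HOL-Library.Poly_Mapping\<close>.\<close>

type_synonym 'g free_alg = "'g fword \<Rightarrow>\<^sub>0 complex"

definition scal :: "complex \<Rightarrow> 'g free_alg" where
  "scal c = Poly_Mapping.single 0 c"

definition gen :: "'g \<Rightarrow> 'g free_alg" where
  "gen g = Poly_Mapping.single (Word [g]) 1"

inductive_set two_sided_ideal :: "'a::ring_1 set \<Rightarrow> 'a set" for S :: "'a set" where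
  zero: "0 \<in> two_sided_ideal S"
| add: "x \<in> two_sided_ideal S \<Longrightarrow> s \<in> S \<Longrightarrow> x + a * s * b \<in> two_sided_ideal S"

section \<open>Matrices\<close>

definition smult_mat :: "complex \<Rightarrow> 'g free_alg ^ 'c ^ 'r \<Rightarrow> 'g free_alg ^ 'c ^ 'r"  (infixr "\<odot>" 75)
  where "c \<odot> A = (\<chi> i j. scal c * A $ i $ j)"

definition cmat :: "complex ^ 'c ^ 'r \<Rightarrow> 'g free_alg ^ 'c ^ 'r" where
  "cmat A = (\<chi> i j. scal (A $ i $ j))"

definition entries :: "'a ^ 'c ^ 'r \<Rightarrow> 'a set" where
  "entries A = {A $ i $ j | i j. True}"

text \<open>\<open>leg1 Y = Y \<otimes> 1\<close> and \<open>leg2 Y = 1 \<otimes> Y\<close>.\<close>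

definition leg1 :: "'a::zero ^ 'n ^ 'n \<Rightarrow> 'a ^ ('n \<times> 'n) ^ ('n \<times> 'n)" where
  "leg1 Y = (\<chi> i j. if snd i = snd j then Y $ fst i $ fst j else 0)"

definition leg2 :: "'a::zero ^ 'n ^ 'n \<Rightarrow> 'a ^ ('n \<times> 'n) ^ ('n \<times> 'n)" where
  "leg2 Y = (\<chi> i j. if fst i = fst j then Y $ snd i $ snd j else 0)"

definition commutator_mat :: "'a::ring_1 \<Rightarrow> 'a ^ 'c ^ 'r \<Rightarrow> 'a ^ 'c ^ 'r" where
  "commutator_mat x Y = (\<chi> i j. x * Y $ i $ j - Y $ i $ j * x)"

definition anticommutator_mat :: "'a::ring_1 \<Rightarrow> 'a ^ 'c ^ 'r \<Rightarrow> 'a ^ 'c ^ 'r" where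
  "anticommutator_mat x Y = (\<chi> i j. x * Y $ i $ j + Y $ i $ j * x)"

section \<open>The Drinfeld--Jimbo matrix and the quantum trace\<close>

definition qlam :: "complex \<Rightarrow> complex" where
  "qlam q = q - inverse q"

definition delta :: "'i \<Rightarrow> 'i \<Rightarrow> complex" where
  "delta i j = (if i = j then 1 else 0)"

definition perm12 :: "complex ^ ('n::finite \<times> 'n) ^ ('n \<times> 'n)" where
  "perm12 = (\<chi> i j. delta (fst i) (snd j) * delta (snd i) (fst j))"

definition R12 :: "complex \<Rightarrow> complex ^ ('n::{finite,linorder} \<times> 'n) ^ ('n \<times> 'n)" where
  "R12 q = (\<chi> i j.
     delta (fst i) (fst j) * delta (snd i) (snd j) * (1 + (q - 1) * delta (fst i) (snd i))
     + (q - inverse q) * delta (fst i) (snd j) * delta (snd i) (fst j)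
         * (if fst i > snd i then 1 else 0))"

definition Rhat :: "complex \<Rightarrow> complex ^ ('n::{finite,linorder} \<times> 'n) ^ ('n \<times> 'n)" where
  "Rhat q = perm12 ** R12 q"

text \<open>\<open>card {i<..}\<close> is \<open>N - i\<close> when the index \<open>i\<close> is identified with its position
  in \<open>1, ..., N\<close>.\<close>

definition Dinv :: "complex \<Rightarrow> complex ^ 'n::{finite,linorder} ^ 'n::{finite,linorder}" where
  "Dinv q = (\<chi> i j. q ^ (2 * card {i<..} + 1) * delta i j)"

definition Trq :: "complex \<Rightarrow> 'g free_alg ^ 'n::{finite,linorder} ^ 'n::{finite,linorder} \<Rightarrow> 'g free_alg" where
  "Trq q Y = trace (cmat (Dinv q) ** Y)"

section \<open>The differential algebra\<close>

datatype 'n dgen = GenT 'n 'n | GenOmega 'n 'n | GenL 'n 'n | GenLinv 'n 'n | GenJ 'n 'n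

definition matT :: "'n dgen free_alg ^ 'n ^ 'n" where "matT = (\<chi> i j. gen (GenT i j))"
definition matOmega :: "'n dgen free_alg ^ 'n ^ 'n" where "matOmega = (\<chi> i j. gen (GenOmega i j))"
definition matL :: "'n dgen free_alg ^ 'n ^ 'n" where "matL = (\<chi> i j. gen (GenL i j))"
definition matLinv :: "'n dgen free_alg ^ 'n ^ 'n" where "matLinv = (\<chi> i j. gen (GenLinv i j))"
definition matJ :: "'n dgen free_alg ^ 'n ^ 'n" where "matJ = (\<chi> i j. gen (GenJ i j))"

text \<open>An equation \<open>A = B\<close> between matrices is encoded by the entries of \<open>A - B\<close>.\<close>

definition diff_relations :: "complex \<Rightarrow> 'n::{finite,linorder} dgen free_alg set" where
  "diff_relations q =
    (let R = cmat (Rhat q); Ri = cmat (matrix_inv (Rhat q));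
         T1 = leg1 matT; T2 = leg2 matT;
         w1 = leg1 matOmega; w2 = leg2 matOmega;
         L1 = leg1 matL; L2 = leg2 matL;
         J1 = leg1 matJ; J2 = leg2 matJ
     in entries (matL ** matLinv - mat 1)
      \<union> entries (matLinv ** matL - mat 1)
      \<union> entries (w2 ** Ri ** w2 ** R - (- (Ri ** w2 ** Ri ** w2)))
      \<union> entries (w2 ** R ** L2 ** R - R ** L2 ** R ** w2)
      \<union> entries ((w2 ** R ** J2 ** R + R ** J2 ** R ** w2) - (- R))
      \<union> entries (L2 ** R ** L2 ** R - R ** L2 ** R ** L2)
      \<union> entries (J2 ** R ** L2 ** R - R ** L2 ** R ** J2)
      \<union> entries (J2 ** R ** J2 ** R - (- (Ri ** J2 ** R ** J2)))
      \<union> entries (R ** T1 ** T2 - T1 ** T2 ** R)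
      \<union> entries (w1 ** T2 - T2 ** Ri ** w2 ** Ri)
      \<union> entries (J1 ** T2 - T2 ** R ** J2 ** R)
      \<union> entries (L1 ** T2 - T2 ** R ** L2 ** R))"

text \<open>Equality in the differential algebra, for elements and for matrices.\<close>

definition diff_eq ::
  "complex \<Rightarrow> 'n::{finite,linorder} dgen free_alg \<Rightarrow> 'n dgen free_alg \<Rightarrow> bool" where
  "diff_eq q x y \<longleftrightarrow> x - y \<in> two_sided_ideal (diff_relations q)"

definition diff_eq_mat ::
  "complex \<Rightarrow> 'n::{finite,linorder} dgen free_alg ^ 'n::{finite,linorder} ^ 'n::{finite,linorder} \<Rightarrow> 'n dgen free_alg ^ 'n::{finite,linorder} ^ 'n::{finite,linorder} \<Rightarrow> bool"
  where "diff_eq_mat q X Y \<longleftrightarrow> (\<forall>i j. diff_eq q (X $ i $ j) (Y $ i $ j))"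

section \<open>The anti-BRST operator\<close>

text \<open>
  Sign pitfall: with the relations above one has \<open>[Q, T] = - q^(2N) T J\<close> and
  \<open>[Q, J]\<^sub>+ = q^(2N) J J\<close>, whereas the source prints both right-hand sides with the opposite sign.
  For \<open>N = 1\<close> and \<open>q^2 \<noteq> -1\<close>: \<open>J J = 0\<close>, \<open>J T = q^2 T J\<close>,
  \<open>L\<^sup>-\<^sup>1 T = q^(-2) T L\<^sup>-\<^sup>1\<close> and \<open>Q = q J (L\<^sup>-\<^sup>1 - 1) / \<lambda>\<close>, hence
  \<open>[Q, T] = - q (q^2 - 1) / \<lambda> T J = - q^2 T J\<close>, and \<open>T J \<noteq> 0\<close>.
  The condition \<open>q^2 \<noteq> -1\<close> cannot be dropped: otherwise the quadratic relations of \<open>J\<close> and \<open>\<omega>\<close>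
  are vacuous for \<open>N = 1\<close> and \<open>Q Q = 0\<close> fails.
\<close>

definition Qstar :: "complex \<Rightarrow> 'n::{finite,linorder} dgen free_alg" where
  "Qstar q = Trq q (matJ ** ((1 / qlam q) \<odot> (matLinv - mat 1))
                    + matJ ** matLinv ** matJ ** matOmega)"

definition Theta_star :: "complex \<Rightarrow> 'n::{finite,linorder} dgen free_alg ^ 'n::{finite,linorder} ^ 'n::{finite,linorder}" where
  "Theta_star q = matJ ** matLinv ** (mat 1 + qlam q \<odot> (matJ ** matOmega))"

definition matW :: "complex \<Rightarrow> 'n::{finite,linorder} dgen free_alg ^ 'n::{finite,linorder} ^ 'n::{finite,linorder}" where
  "matW q = mat 1 + qlam q \<odot> (matOmega ** matJ)"

definition matWbar :: "complex \<Rightarrow> 'n::{finite,linorder} dgen free_alg ^ 'n::{finite,linorder} ^ 'n::{finite,linorder}" where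
  "matWbar q = mat 1 + qlam q \<odot> (matJ ** matOmega)"

end

(*
  Write R for Rhat, put all matrices in leg 2 and let Tr_1 be the quantum trace over leg 1.  Then
  Tr_1(R X R^-1) = Tr_1(R^-1 X R) = Tr_q(X) and Tr_1(R) = q^(2N), so that a relation between
  R X R^-1, R^-1 X R and Y becomes, under Tr_1, a commutation rule of Tr_q(X) with Y.
  Theta = J L^-1 (1 + lambda J w) satisfies
    R^-1 Theta R J = - J R Theta R^-1,
    R Theta R^-1 w = - w R Theta R - L^-1 (1 + lambda J w) R,
    R^-1 Theta R Theta = - Theta R Theta R,
  and R Theta R^-1 intertwines with T; the last relation is also that of J.  For X with that
  relation the trace over both legs gives 2 t^2 = - lambda q^(2N) s and 2 q^(2N) s = lambda t^2
  with t = Tr_q(X), s = Tr_q(X^2), so (4 + lambda^2) t^2 = 0, and 4 + lambda^2 = (q + 1/q)^2.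
  Thus Q = (Tr_q(Theta) - Tr_q(J)) / lambda squares to zero, as both traces do and anticommute.
*)
theory Submission
  imports Defs
begin

section \<open>Reflection algebra relations\<close>

text \<open>Where the right-hand sides come from: since R = R^-1 + lambda, the partial trace of R X
  R differs from that of the conjugate R X R^-1 by lambda q^(2N) X. The factors of Theta are
  balanced so that Theta meets L, J and T through conjugates only; hence its trace commutes or
  anticommutes with them without correction. The q^(2N) terms for T and J thus come from Tr_q(J)
  alone, and the 1/lambda in Q removes their lambda. For w, the inhomogeneous term of the w-J
  relation contributes as well. The obstacle is that matrix entries do not commute: a trace is not
  cyclic, only a numerical R may be moved around, and left and right multiplication by Tr_q(X)
  differ. So the relations are first derived between whole matrices, and a trace is applied only to
  finished relations.\<close>

lemma matrix_add_rdistrib: "(A + B) ** C = A ** C + B ** (C :: 'a::semiring_1 ^ 'p ^ 'm)"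
  by (simp add: matrix_matrix_mult_def vec_eq_iff sum.distrib distrib_right)

lemma matrix_mul_minus_left [simp]: "(- A) ** B = - (A ** (B :: 'a::ring_1 ^ 'p ^ 'm))"
  by (simp add: matrix_matrix_mult_def vec_eq_iff sum_negf)

lemma matrix_mul_minus_right [simp]: "A ** (- B) = - (A ** (B :: 'a::ring_1 ^ 'p ^ 'm))"
  by (simp add: matrix_matrix_mult_def vec_eq_iff sum_negf)

lemma matrix_mul_diff_left: "(A - B) ** C = A ** C - B ** (C :: 'a::ring_1 ^ 'p ^ 'm)"
  using matrix_add_rdistrib[of A "- B" C] by simp

lemma matrix_mul_diff_right: "A ** (B - C) = A ** B - A ** (C :: 'a::ring_1 ^ 'p ^ 'm)"
  using matrix_add_ldistrib[of A B "- C"] by simp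

lemmas matrix_distribs =
  matrix_add_ldistrib matrix_add_rdistrib matrix_mul_diff_left matrix_mul_diff_right

text \<open>All matrices here will be leg-2 matrices or numerical ones, so the legs become invisible
  and an algebra of square matrices remains. \<open>K\<close> will be lambda times the identity. The
  reflection equation of \<open>L\<close> appears as the premise \<open>central_L L\<close> where it
  is used.\<close>

locale reflection_algebra =
  fixes R Ri K J L Li w :: "'a::ring_1 ^ 'm ^ 'm"
  assumes R_Ri: "R ** Ri = mat 1" and Ri_R: "Ri ** R = mat 1"
    and hecke: "R = Ri + K" and K_comm: "\<And>X :: 'a ^ 'm ^ 'm. K ** X = X ** K"
    and L_Li: "L ** Li = mat 1" and Li_L: "Li ** L = mat 1"
    and J_L: "J ** R ** L ** R = R ** L ** R ** J"
    and w_L: "w ** R ** L ** R = R ** L ** R ** w"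
    and J_J: "J ** R ** J ** R = - (Ri ** J ** R ** J)"
    and w_w: "w ** Ri ** w ** R = - (Ri ** w ** Ri ** w)"
    and w_J: "w ** R ** J ** R + R ** J ** R ** w = - R"
begin

definition "Wb = mat 1 + K ** J ** w"
definition "Th = J ** Li ** Wb"

abbreviation "central_L X \<equiv> X ** R ** L ** R = R ** L ** R ** X"

lemma cancel [simp]:
  "R ** (Ri ** X) = X" "Ri ** (R ** X) = X" "L ** (Li ** X) = X" "Li ** (L ** X) = X"
  using R_Ri Ri_R L_Li Li_L by (simp_all add: matrix_mul_assoc)

lemmas assoc = matrix_mul_assoc[symmetric]

lemma K_left_comm: "X ** (K ** Y) = K ** (X ** Y)"
  by (metis K_comm matrix_mul_assoc)

lemma R_conj: "R ** X ** R = Ri ** X ** R + K ** X ** R"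
  by (subst (1) hecke) (simp add: matrix_distribs)

text \<open>Multiplying by \<open>Ri\<close> on both sides produces the two conjugates of
  \<open>X\<close>, the shape that the trace over leg 1 can evaluate.\<close>

lemma conj_L_comm:
  assumes "central_L X"
  shows "Ri ** X ** R ** L = L ** R ** X ** Ri"
proof -
  have "Ri ** X ** R ** L = Ri ** (X ** R ** L ** R) ** Ri"
    by (simp add: assoc R_Ri)
  also have "\<dots> = L ** R ** X ** Ri" unfolding assms by (simp add: assoc)
  finally show ?thesis .
qed

lemma conj_Li:
  assumes "central_L X"
  shows "R ** X ** Ri ** Li = Li ** Ri ** X ** R"
proof -
  have "Li ** Ri ** X ** R = Li ** (Ri ** X ** R ** L) ** Li"
    by (simp add: assoc L_Li)
  also have "\<dots> = R ** X ** Ri ** Li"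
    unfolding conj_L_comm[OF assms] by (simp add: assoc)
  finally show ?thesis ..
qed

text \<open>Such matrices are those commuting with the fixed matrix \<open>R ** L ** R\<close>. They
  form a subring, so \<open>Th\<close> inherits the property from its factors.\<close>

lemma central_L_mult:
  assumes "central_L X" "central_L Y" shows "central_L (X ** Y)"
proof -
  have "X ** Y ** R ** L ** R = X ** (Y ** R ** L ** R)" by (simp add: assoc)
  also have "\<dots> = (X ** R ** L ** R) ** Y" unfolding assms(2) by (simp add: assoc)
  finally show ?thesis unfolding assms(1) by (simp add: assoc)
qed

lemma central_L_add:
  assumes "central_L X" "central_L Y" shows "central_L (X + Y)"
  using assms by (simp add: matrix_distribs)

lemma central_L_K: "central_L K" and central_L_1: "central_L (mat 1)"
  by (simp_all add: K_comm assoc)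

lemma central_L_L: assumes "central_L L" shows "central_L Li"
proof -
  have "Li ** R ** L ** R = Li ** (R ** L ** R ** L) ** Li" by (simp add: assoc L_Li)
  also have "\<dots> = R ** L ** R ** Li" unfolding assms[symmetric] by (simp add: assoc)
  finally show ?thesis .
qed

text \<open>The inhomogeneous term \<open>- R\<close> of \<open>w_J\<close> contributes
  \<open>- (K ** J ** R)\<close>, which by the Hecke relation turns the leading
  \<open>R ** J ** R\<close> into \<open>Ri ** J ** R\<close>. The coefficient \<open>K\<close> in
  \<open>Wb\<close> is made for this cancellation.\<close>

lemma Wb_J: "Wb ** R ** J ** R = Ri ** J ** R ** Wb"
proof -
  have "w ** R ** J ** R = - R - R ** J ** R ** w"
    using w_J by (simp add: eq_diff_eq)
  then have "J ** w ** R ** J ** R = J ** (- R - R ** J ** R ** w)"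
    by (simp add: assoc)
  also have "\<dots> = - (J ** R) - (J ** R ** J ** R) ** w"
    by (simp add: assoc matrix_distribs)
  also have "\<dots> = - (J ** R) + Ri ** J ** R ** J ** w" by (simp add: J_J)
  finally have "Wb ** R ** J ** R = R ** J ** R + K ** (- (J ** R) + Ri ** J ** R ** J ** w)"
    by (simp add: Wb_def matrix_distribs assoc)
  then show ?thesis
    by (simp add: Wb_def matrix_distribs assoc K_left_comm) (simp add: matrix_mul_assoc R_conj)
qed

text \<open>\<open>J\<close> moves leftwards through \<open>Wb\<close>, \<open>Li\<close> and
  \<open>J\<close> in turn; only the last exchange produces a sign.\<close>

lemma Th_J: "Ri ** Th ** R ** J = - (J ** R ** Th ** Ri)"
proof -
  have "Ri ** Th ** R ** J = Ri ** J ** Li ** (Wb ** R ** J ** R) ** Ri"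
    by (simp add: Th_def assoc R_Ri)
  also have "\<dots> = Ri ** J ** (Li ** Ri ** J ** R) ** Wb ** Ri"
    unfolding Wb_J by (simp add: assoc)
  also have "\<dots> = (Ri ** J ** R ** J) ** Ri ** Li ** Wb ** Ri"
    unfolding conj_Li[OF J_L, symmetric] by (simp add: assoc)
  also have "Ri ** J ** R ** J = - (J ** R ** J ** R)" by (simp add: J_J)
  finally show ?thesis by (simp add: Th_def assoc)
qed

lemma w_J': "Ri ** w ** R ** J = - Ri - J ** R ** w ** Ri"
proof -
  have "Ri ** w ** R ** J + J ** R ** w ** Ri
      = Ri ** (w ** R ** J ** R + R ** J ** R ** w) ** Ri"
    by (simp add: assoc matrix_distribs R_Ri)
  also have "\<dots> = - Ri" unfolding w_J by (simp add: Ri_R)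
  finally show ?thesis by (simp add: eq_diff_eq)
qed

text \<open>Counterpart of \<open>Wb_J\<close>: the term \<open>- Ri\<close> of \<open>w_J'\<close>
  now cancels the Hecke correction between \<open>Ri ** w ** R\<close> and
  \<open>Ri ** w ** Ri\<close>.\<close>

lemma w_Wb: "Ri ** w ** R ** Wb = Wb ** Ri ** w ** Ri"
proof -
  have "R ** w ** Ri ** w = R ** (w ** Ri ** w ** R) ** Ri"
    by (simp add: assoc R_Ri)
  also have "\<dots> = - (w ** Ri ** w ** Ri)"
    unfolding w_w by (simp add: assoc)
  finally have "J ** (R ** w ** Ri ** w) = - (J ** (w ** Ri ** w ** Ri))" by simp
  then have "J ** R ** w ** Ri ** w = - (J ** w ** Ri ** w ** Ri)"
    by (simp add: matrix_mul_assoc)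
  then have "Ri ** w ** R ** J ** w = J ** w ** Ri ** w ** Ri - Ri ** w"
    unfolding w_J' by (simp add: matrix_distribs)
  then have e1: "Ri ** w ** R ** Wb
      = Ri ** w ** R + K ** (J ** w ** Ri ** w ** Ri - Ri ** w)"
    by (simp add: Wb_def matrix_distribs assoc K_left_comm)
  have e2: "Ri ** w ** R = Ri ** w ** Ri + K ** Ri ** w"
    by (simp add: hecke matrix_distribs K_comm)
       (simp add: K_comm flip: matrix_mul_assoc)
  show ?thesis unfolding e1 unfolding e2 by (simp add: Wb_def matrix_distribs assoc)
qed

lemma Th_w: "R ** Th ** Ri ** w = - (w ** R ** Th ** R) - Li ** Wb ** R"
proof -
  have "R ** Th ** Ri ** w = R ** J ** Li ** (Wb ** Ri ** w ** Ri) ** R"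
    by (simp add: Th_def assoc Ri_R)
  also have "\<dots> = R ** J ** (Li ** Ri ** w ** R) ** Wb ** R"
    unfolding w_Wb[symmetric] by (simp add: assoc)
  also have "\<dots> = (R ** J ** R ** w) ** Ri ** Li ** Wb ** R"
    unfolding conj_Li[OF w_L, symmetric] by (simp add: assoc)
  \<comment> \<open>The summand \<open>- R\<close> cancels the \<open>Ri\<close> that follows and
    leaves \<open>Li ** Wb ** R\<close>, a term without \<open>J\<close> in front.\<close>
  also have "R ** J ** R ** w = - R - w ** R ** J ** R"
    using w_J by (simp add: eq_diff_eq add.commute)
  finally show ?thesis by (simp add: Th_def assoc matrix_distribs)
qed

lemma Th_Wb: "Ri ** Th ** R ** Wb = Wb ** R ** Th ** R"
proof -
  have "Ri ** Th ** R ** J ** w = - (J ** (R ** Th ** Ri ** w))"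
    unfolding Th_J by (simp add: assoc)
  also have "\<dots> = J ** w ** R ** Th ** R + Th ** R"
    unfolding Th_w by (simp add: assoc matrix_distribs Th_def)
  finally show ?thesis
    by (simp add: Wb_def matrix_distribs assoc K_left_comm)
       (simp add: matrix_mul_assoc R_conj)
qed

lemma central_L_Th:
  assumes "central_L L" shows "central_L Th"
  unfolding Th_def Wb_def
  by (intro central_L_mult central_L_add central_L_K central_L_1 J_L w_L central_L_L assms)

text \<open>Only the second \<open>Th\<close> is expanded; the conjugated first one passes
  \<open>J\<close>, \<open>Li\<close> and \<open>Wb\<close> one after another, by
  \<open>Th_J\<close>, by commutation with \<open>L\<close> and by \<open>Th_Wb\<close>.\<close>

lemma Th_Th:
  assumes "central_L L" shows "Th ** R ** Th ** R = - (Ri ** Th ** R ** Th)"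
proof -
  have "Ri ** Th ** R ** Th = (Ri ** Th ** R ** J) ** Li ** Wb"
    by (simp add: Th_def assoc)
  also have "\<dots> = - (J ** (R ** Th ** Ri ** Li) ** Wb)"
    unfolding Th_J by (simp add: assoc)
  also have "\<dots> = - (J ** Li ** (Ri ** Th ** R ** Wb))"
    unfolding conj_Li[OF central_L_Th[OF assms]] by (simp add: assoc)
  also have "\<dots> = - (Th ** R ** Th ** R)"
    unfolding Th_Wb by (simp add: Th_def assoc)
  finally show ?thesis by simp
qed

end

section \<open>Partial quantum trace\<close>

lemma mat_mul_nth [simp]: "(mat s ** A) $ i $ j = s * (A :: 'a::ring_1 ^ 'p ^ 'm) $ i $ j"
  by (simp add: matrix_matrix_mult_def mat_def if_distrib if_distribR cong: if_cong)

lemma mul_mat_nth [simp]: "(A ** mat s) $ i $ j = (A :: 'a::ring_1 ^ 'p ^ 'm) $ i $ j * s"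
  by (simp add: matrix_matrix_mult_def mat_def if_distrib if_distribR cong: if_cong)

lemma sum_UNIV_pair: "(\<Sum>p\<in>UNIV. f p) = (\<Sum>a\<in>UNIV. \<Sum>b\<in>UNIV. f (a, b))"
  for f :: "'b::finite \<times> 'c::finite \<Rightarrow> 'd::comm_monoid_add"
  by (simp add: sum.cartesian_product)

lemma sum_if_fixed: "(\<Sum>k\<in>UNIV. if P then f k else 0) = (if P then \<Sum>k\<in>UNIV. f k else 0)"
  for f :: "'b::finite \<Rightarrow> 'c::comm_monoid_add"
  by simp

lemma mult_if_zero:
  "x * (if P then y else 0) = (if P then x * y else 0)"
  "(if P then y else 0) * x = (if P then y * x else 0)" for x y :: "'b::ring_1"
  by simp_all

lemma mul_leg2_nth: "(A ** leg2 Y) $ p $ (a, b) = (\<Sum>k\<in>UNIV. A $ p $ (a, k) * Y $ k $ b)"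
  and leg2_mul_nth: "(leg2 Y ** A) $ (a, b) $ p = (\<Sum>k\<in>UNIV. Y $ b $ k * A $ (a, k) $ p)"
  and mul_leg1_nth: "(A ** leg1 Y) $ p $ (a, b) = (\<Sum>k\<in>UNIV. A $ p $ (k, b) * Y $ k $ a)"
  for A :: "'a::ring_1 ^ ('n::finite \<times> 'n) ^ ('n \<times> 'n)"
  by (simp_all add: leg1_def leg2_def matrix_matrix_mult_def sum_UNIV_pair mult_if_zero sum_if_fixed)

lemma leg2_mult: "leg2 (A ** B) = leg2 A ** leg2 (B :: 'a::ring_1 ^ 'n ^ 'n)"
  by (simp add: vec_eq_iff mul_leg2_nth)
     (simp add: leg2_def matrix_matrix_mult_def)

lemma leg1_mult: "leg1 (A ** B) = leg1 A ** leg1 (B :: 'a::ring_1 ^ 'n ^ 'n)"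
  by (simp add: vec_eq_iff mul_leg1_nth)
     (simp add: leg1_def matrix_matrix_mult_def)

lemma leg_add:
  "leg1 (A + B) = leg1 A + leg1 (B :: 'a::ring_1 ^ 'n ^ 'n)"
  "leg2 (A + B) = leg2 A + leg2 (B :: 'a::ring_1 ^ 'n ^ 'n)"
  by (simp_all add: leg1_def leg2_def vec_eq_iff)

lemma leg_mat: "leg1 (mat s) = mat s" "leg2 (mat s) = mat s"
  by (auto simp add: leg1_def leg2_def mat_def vec_eq_iff prod_eq_iff)

text \<open>\<open>d\<close> is the diagonal of D^-1. \<open>skew1\<close> and \<open>skew2\<close>
  are the trace identities for the two conjugates of a leg-2 matrix with its entries stripped off,
  and \<open>weight\<close> says that \<open>R\<close> commutes with the tensor square of D^-1. They
  stay entrywise because the explicit matrix is checked entry by entry.\<close>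

locale quantum_trace =
  fixes R Ri :: "'a::ring_1 ^ ('n::finite \<times> 'n) ^ ('n \<times> 'n)" and d :: "'n \<Rightarrow> 'a" and lam c :: 'a
  assumes R_central: "\<And>i j x. R $ i $ j * x = x * R $ i $ j"
    and d_central: "\<And>a x. d a * x = x * d a"
    and lam_central: "\<And>x. lam * x = x * lam"
    and c_central: "\<And>x. c * x = x * c"
    and R_Ri: "R ** Ri = mat 1" and Ri_R: "Ri ** R = mat 1" and hecke: "R = Ri + mat lam"
    and skew1: "\<And>i j l m. (\<Sum>a\<in>UNIV. \<Sum>k\<in>UNIV. d a * (R $ (a, i) $ (k, l) * Ri $ (k, m) $ (a, j)))
      = (if i = j \<and> l = m then d l else 0)"
    and skew2: "\<And>i j l m. (\<Sum>a\<in>UNIV. \<Sum>k\<in>UNIV. d a * (Ri $ (a, i) $ (k, l) * R $ (k, m) $ (a, j)))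
      = (if i = j \<and> l = m then d l else 0)"
    and contract: "\<And>i j. (\<Sum>a\<in>UNIV. d a * R $ (a, i) $ (a, j)) = (if i = j then c else 0)"
    and weight: "\<And>a b k l. d a * d b * R $ (a, b) $ (k, l) = d k * d l * R $ (a, b) $ (k, l)"
begin

definition "ptr A = (\<chi> i j. \<Sum>a\<in>UNIV. d a * A $ (a, i) $ (a, j))"
  for A :: "'a ^ ('n \<times> 'n) ^ ('n \<times> 'n)"
definition "trq Y = (\<Sum>a\<in>UNIV. d a * Y $ a $ a)" for Y :: "'a ^ 'n ^ 'n"

lemma Ri_eq: "Ri = R - mat lam" by (simp add: hecke)

lemma Ri_central: "Ri $ i $ j * x = x * Ri $ i $ j"
  by (simp add: Ri_eq mat_def algebra_simps R_central lam_central)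

lemma lam_mat_comm: "mat lam ** (X :: 'a ^ 'p ^ 'p) = X ** mat lam"
  by (simp add: vec_eq_iff lam_central)

lemma c_mat_comm: "mat c ** (X :: 'a ^ 'p ^ 'p) = X ** mat c"
  by (simp add: vec_eq_iff c_central)

lemma ptr_add: "ptr (A + B) = ptr A + ptr B" and ptr_minus: "ptr (- A) = - ptr A"
  and ptr_diff: "ptr (A - B) = ptr A - ptr B"
  by (simp_all add: ptr_def vec_eq_iff algebra_simps sum.distrib sum_negf sum_subtractf)

lemma trq_add: "trq (A + B) = trq A + trq B" and trq_minus: "trq (- A) = - trq A"
  and trq_diff: "trq (A - B) = trq A - trq B"
  by (simp_all add: trq_def algebra_simps sum.distrib sum_negf sum_subtractf)

lemma d_left_comm: "x * (d a * y) = d a * (x * y)"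
  by (metis d_central mult.assoc)

lemma ptr_mul_leg2: "ptr (A ** leg2 Y) = ptr A ** Y"
proof -
  have "ptr (A ** leg2 Y) $ i $ j = (ptr A ** Y) $ i $ j" for i j
    by (simp add: ptr_def mul_leg2_nth sum_distrib_left)
       (subst sum.swap, simp add: matrix_matrix_mult_def sum_distrib_right mult.assoc)
  then show ?thesis by (simp add: vec_eq_iff)
qed

lemma ptr_leg2_mul: "ptr (leg2 Y ** A) = Y ** ptr A"
proof -
  have "ptr (leg2 Y ** A) $ i $ j = (Y ** ptr A) $ i $ j" for i j
    by (simp add: ptr_def leg2_mul_nth sum_distrib_left)
       (subst sum.swap, simp add: matrix_matrix_mult_def sum_distrib_left d_left_comm)
  then show ?thesis by (simp add: vec_eq_iff)
qed

lemma ptr_mul_mat: "ptr (A ** mat s) = ptr A ** mat s"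
  using ptr_mul_leg2[of A "mat s"] by (simp add: leg_mat)

lemma ptr_mat_mul: "ptr (mat s ** A) = mat s ** ptr A"
  using ptr_leg2_mul[of "mat s" A] by (simp add: leg_mat)

lemma ptr_leg1: "ptr (leg1 Y) = mat (trq Y)"
  by (simp add: ptr_def trq_def leg1_def mat_def vec_eq_iff)

lemma ptr_R: "ptr R = mat c"
  by (simp add: ptr_def mat_def vec_eq_iff contract)

lemma trq_mat_mul: "trq (mat s ** Y) = s * trq Y"
  by (simp add: trq_def sum_distrib_left d_left_comm)

text \<open>Numerical entries can be collected in front of those of \<open>Y\<close>; the
  coefficient of \<open>Y $ l $ m\<close> is then the left side of \<open>skew\<close>.\<close>

lemma ptr_conj_aux:
  assumes A: "\<And>i j x. A $ i $ j * x = x * A $ i $ j" and B: "\<And>i j x. B $ i $ j * x = x * B $ i $ j"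
    and skew: "\<And>i j l m. (\<Sum>a\<in>UNIV. \<Sum>k\<in>UNIV. d a * (A $ (a, i) $ (k, l) * B $ (k, m) $ (a, j)))
      = (if i = j \<and> l = m then d l else 0)"
  shows "ptr (A ** leg2 Y ** B) = mat (trq Y)"
proof -
  have "(\<Sum>a\<in>UNIV. d a * (A ** leg2 Y ** B) $ (a, i) $ (a, j)) = mat (trq Y) $ i $ j" for i j
  proof -
    have *: "(A ** leg2 Y ** B) $ (a, i) $ (a, j)
        = (\<Sum>k\<in>UNIV. \<Sum>m\<in>UNIV. \<Sum>l\<in>UNIV. A $ (a, i) $ (k, l) * B $ (k, m) $ (a, j) * Y $ l $ m)" for a
      unfolding matrix_matrix_mult_def[of "A ** leg2 Y"]
      by (simp add: sum_UNIV_pair mul_leg2_nth sum_distrib_right mult.assoc B[of _ _ "Y $ _ $ _"])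
    have "(\<Sum>a\<in>UNIV. d a * (A ** leg2 Y ** B) $ (a, i) $ (a, j))
      = (\<Sum>a\<in>UNIV. \<Sum>k\<in>UNIV. \<Sum>m\<in>UNIV. \<Sum>l\<in>UNIV. d a * (A $ (a, i) $ (k, l) * B $ (k, m) $ (a, j)) * Y $ l $ m)"
      unfolding * by (simp add: sum_distrib_left mult.assoc)
    also have "\<dots> = (\<Sum>m\<in>UNIV. \<Sum>a\<in>UNIV. \<Sum>k\<in>UNIV. \<Sum>l\<in>UNIV. d a * (A $ (a, i) $ (k, l) * B $ (k, m) $ (a, j)) * Y $ l $ m)"
      by (subst (2) sum.swap, subst sum.swap) simp
    also have "\<dots> = (\<Sum>m\<in>UNIV. \<Sum>l\<in>UNIV. \<Sum>a\<in>UNIV. \<Sum>k\<in>UNIV. d a * (A $ (a, i) $ (k, l) * B $ (k, m) $ (a, j)) * Y $ l $ m)"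
      by (rule sum.cong[OF refl], subst (2) sum.swap, subst sum.swap) simp
    also have "\<dots> = (\<Sum>m\<in>UNIV. \<Sum>l\<in>UNIV. (if i = j \<and> l = m then d l else 0) * Y $ l $ m)"
      unfolding skew[symmetric] by (simp add: sum_distrib_right)
    also have "\<dots> = mat (trq Y) $ i $ j"
      by (cases "i = j") (simp_all add: mat_def trq_def mult_if_zero)
    finally show ?thesis .
  qed
  then show ?thesis by (simp add: ptr_def vec_eq_iff)
qed

lemma ptr_conj:
  "ptr (R ** leg2 Y ** Ri) = mat (trq Y)" "ptr (Ri ** leg2 Y ** R) = mat (trq Y)"
  by (intro ptr_conj_aux R_central Ri_central skew1 skew2)+

text \<open>The trace over both legs is cyclic for this factor because its entries are central and
  \<open>weight\<close> carries the two weights from its rows to its columns.\<close>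

lemma trq_ptr_cyclic: "trq (ptr (R ** A)) = trq (ptr (A ** R))"
proof -
  have tp: "trq (ptr X) = (\<Sum>p\<in>UNIV. d (fst p) * d (snd p) * X $ p $ p)" for X
    by (simp add: trq_def ptr_def sum_UNIV_pair sum_distrib_left mult.assoc)
       (subst sum.swap, intro sum.cong refl d_left_comm)
  have "trq (ptr (R ** A))
      = (\<Sum>p\<in>UNIV. \<Sum>r\<in>UNIV. d (fst p) * d (snd p) * R $ p $ r * A $ r $ p)"
    by (simp add: tp matrix_matrix_mult_def sum_distrib_left mult.assoc)
  also have "\<dots> = (\<Sum>p\<in>UNIV. \<Sum>r\<in>UNIV. d (fst r) * d (snd r) * R $ p $ r * A $ r $ p)"
    by (intro sum.cong refl) (metis weight prod.collapse)
  also have "\<dots> = (\<Sum>r\<in>UNIV. \<Sum>p\<in>UNIV. d (fst r) * d (snd r) * R $ p $ r * A $ r $ p)"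
    by (rule sum.swap)
  also have "\<dots> = trq (ptr (A ** R))"
    by (simp add: tp matrix_matrix_mult_def sum_distrib_left mult.assoc R_central)
  finally show ?thesis .
qed

lemma R_Ri_cancel: "R ** (Ri ** X) = X" "Ri ** (R ** X) = X"
  using R_Ri Ri_R by (simp_all add: matrix_mul_assoc)

lemma trq_square_zero:
  assumes rel: "leg2 Y ** R ** leg2 Y ** R = - (Ri ** leg2 Y ** R ** leg2 Y)"
    and inv: "e * (4 + lam * lam) = 1"
  shows "trq Y * trq Y = 0"
proof -
  define X t s where "X = leg2 Y" and "t = trq Y" and "s = trq (Y ** Y)"
  have T1: "trq (ptr (Ri ** X ** R ** X)) = t * t"
    by (simp add: X_def t_def ptr_mul_leg2 ptr_conj trq_mat_mul)
  have T2: "trq (ptr (X ** R ** X)) = c * s"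
    by (simp add: X_def s_def ptr_mul_leg2 ptr_leg2_mul ptr_R)
       (simp add: trq_mat_mul matrix_mul_assoc[symmetric] flip: c_mat_comm)
  \<comment> \<open>The double trace of this product is found in two ways: by the Hecke relation,
    and by cyclicity followed by \<open>rel\<close>.\<close>
  have "R ** X ** R ** X = Ri ** X ** R ** X + mat lam ** (X ** R ** X)"
    by (subst (1) hecke) (simp add: matrix_distribs matrix_mul_assoc)
  then have "trq (ptr (R ** X ** R ** X)) = t * t + lam * (c * s)"
    by (simp only: ptr_add trq_add ptr_mat_mul trq_mat_mul T1 T2)
  then have "trq (ptr (X ** R ** X ** R)) = t * t + lam * (c * s)"
    using trq_ptr_cyclic[of "X ** R ** X"] by (simp add: matrix_mul_assoc)
  then have "- (t * t) = lam * (c * s) + t * t"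
    using rel T1 by (simp add: X_def ptr_minus trq_minus add.commute)
  then have "- (t * t) - t * t = lam * (c * s)" by (simp only: diff_eq_eq)
  then have E1: "2 * (t * t) = - (lam * (c * s))"
    by (simp add: mult_2 flip: \<open>- (t * t) - t * t = lam * (c * s)\<close>)
  have "X ** R ** X = (X ** R ** X ** R) ** Ri"
    by (simp add: R_Ri flip: matrix_mul_assoc)
  \<comment> \<open>A factor \<open>R\<close> is split off in front because cyclicity can move only
    \<open>R\<close>.\<close>
  also have "\<dots> = - (R ** (Ri ** Ri ** X ** R ** X ** Ri))"
    using rel by (simp add: X_def R_Ri_cancel flip: matrix_mul_assoc)
  finally have "c * s = - trq (ptr (Ri ** Ri ** X ** R ** X ** Ri ** R))"
    by (simp only: T2[symmetric] ptr_minus trq_minus trq_ptr_cyclic)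
  also have "Ri ** Ri ** X ** R ** X ** Ri ** R = Ri ** Ri ** X ** R ** X"
    by (simp add: Ri_R flip: matrix_mul_assoc)
  also have "Ri ** Ri ** X ** R ** X = X ** R ** X - mat lam ** (Ri ** X ** R ** X)"
    using R_Ri by (subst (1) Ri_eq) (simp add: matrix_distribs R_Ri_cancel flip: matrix_mul_assoc)
  finally have E2: "2 * (c * s) = lam * (t * t)"
    by (simp add: ptr_diff trq_diff ptr_mat_mul trq_mat_mul T1 T2 algebra_simps mult_2)
  \<comment> \<open>Doubling stays inside the ring, where 2 need not be invertible;
    \<open>E1\<close> and \<open>E2\<close> make the two summands opposite.\<close>
  have "(4 + lam * lam) * (t * t) = 2 * (2 * (t * t)) + lam * (lam * (t * t))"
    by (simp add: algebra_simps)
  also have "\<dots> = 0" unfolding E1 E2[symmetric] by (simp add: mult_2 algebra_simps)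
  finally have "e * ((4 + lam * lam) * (t * t)) = 0" by simp
  then show ?thesis by (simp add: inv mult.assoc[symmetric] t_def)
qed

end

section \<open>Commutation relations of the anti-BRST operator\<close>

text \<open>The scalars include noncentral elements such as \<open>trq Theta\<close>. This is
  multiplication from the left, and \<open>A ** mat s\<close> is multiplication from the right, so
  their difference is the matrix of commutators.\<close>

definition smul :: "'a::ring_1 \<Rightarrow> 'a ^ 'p ^ 'm \<Rightarrow> 'a ^ 'p ^ 'm"  (infixr "\<star>" 75)
  where "s \<star> A = (\<chi> i j. s * A $ i $ j)"

lemma smul_nth [simp]: "(s \<star> A) $ i $ j = s * A $ i $ j"
  by (simp add: smul_def)

lemma mat_mul_eq_smul: "mat s ** A = s \<star> A" and smul_mul: "(s \<star> A) ** B = s \<star> (A ** B)"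
  by (simp_all add: vec_eq_iff) (simp add: matrix_matrix_mult_def sum_distrib_left mult.assoc)

lemma smul_distribs: "s \<star> (A + B) = s \<star> A + s \<star> B" "s \<star> (A - B) = s \<star> A - s \<star> B"
  "s \<star> (- A) = - (s \<star> A)" "(s + t) \<star> A = s \<star> A + t \<star> A" "(s - t) \<star> A = s \<star> A - t \<star> A"
  and smul_smul: "(s * t) \<star> A = s \<star> t \<star> A" and smul_one: "1 \<star> A = A"
  and smul_mat_one: "s \<star> mat 1 = mat s"
  by (simp_all add: vec_eq_iff algebra_simps) (simp add: mat_def)

lemma mul_smul_central:
  assumes "\<And>x. s * x = x * s"
  shows "A ** (s \<star> B) = s \<star> (A ** B)" "A ** mat s = s \<star> A"
proof -
  have *: "x * (s * y) = s * (x * y)" for x y using assms by (metis mult.assoc)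
  show "A ** (s \<star> B) = s \<star> (A ** B)"
    by (simp add: vec_eq_iff matrix_matrix_mult_def sum_distrib_left *)
  show "A ** mat s = s \<star> A" by (simp add: vec_eq_iff assms)
qed

lemma smul_commute_central:
  assumes "\<And>x. s * x = x * s" shows "t \<star> s \<star> A = s \<star> t \<star> A"
  by (metis assms smul_smul)

locale anti_brst = quantum_trace R Ri d lam c
  for R Ri :: "'a::ring_1 ^ ('n::finite \<times> 'n) ^ ('n \<times> 'n)" and d and lam c :: 'a +
  fixes lami e :: 'a and T w L Li J :: "'a ^ 'n ^ 'n"
  assumes lami: "lam * lami = 1" and e: "e * (4 + lam * lam) = 1"
    and inverse_L: "L ** Li = mat 1" "Li ** L = mat 1"
    and w_w: "leg2 w ** Ri ** leg2 w ** R = - (Ri ** leg2 w ** Ri ** leg2 w)"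
    and w_L: "leg2 w ** R ** leg2 L ** R = R ** leg2 L ** R ** leg2 w"
    and w_J: "leg2 w ** R ** leg2 J ** R + R ** leg2 J ** R ** leg2 w = - R"
    and L_L: "leg2 L ** R ** leg2 L ** R = R ** leg2 L ** R ** leg2 L"
    and J_L: "leg2 J ** R ** leg2 L ** R = R ** leg2 L ** R ** leg2 J"
    and J_J: "leg2 J ** R ** leg2 J ** R = - (Ri ** leg2 J ** R ** leg2 J)"
    and w_T: "leg1 w ** leg2 T = leg2 T ** Ri ** leg2 w ** Ri"
    and J_T: "leg1 J ** leg2 T = leg2 T ** R ** leg2 J ** R"
    and L_T: "leg1 L ** leg2 T = leg2 T ** R ** leg2 L ** R"
begin

sublocale reflection_algebra R Ri "mat lam" "leg2 J" "leg2 L" "leg2 Li" "leg2 w"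
  by unfold_locales
    (fact R_Ri Ri_R hecke lam_mat_comm J_L w_L J_J w_w w_J
      | simp add: leg_mat inverse_L flip: leg2_mult)+

definition "Wbar = mat 1 + mat lam ** J ** w"
definition "Theta = J ** Li ** Wbar"
definition "Qs = lami * (trq Theta - trq J)"

lemma leg2_Wbar: "leg2 Wbar = Wb" and leg2_Theta: "leg2 Theta = Th"
  by (simp_all add: Theta_def Wbar_def Th_def Wb_def leg2_mult leg_add leg_mat)

lemma lami_central: "lami * x = x * lami"
proof -
  have "lami * x = lami * (x * (lam * lami))" by (simp add: lami)
  also have "\<dots> = (lam * lami) * x * lami"
    by (metis lam_central mult.assoc)
  finally show ?thesis by (simp add: lami)
qed

lemma smul_lami_lam: "lami \<star> lam \<star> A = A" "lam \<star> lami \<star> A = A"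
  using lami lami_central[of lam] by (simp_all add: smul_one flip: smul_smul)

text \<open>The two instances of \<open>smul_commute_central\<close> move \<open>lam\<close> and
  \<open>lami\<close> out past \<open>c\<close>, where they meet and cancel.\<close>

lemmas scalars =
  mat_mul_eq_smul smul_mul smul_distribs smul_lami_lam smul_one
  mul_smul_central[of lam, OF lam_central] mul_smul_central[of c, OF c_central]
  mul_smul_central[of lami, OF lami_central]
  smul_commute_central[where s = lam and t = c, OF lam_central]
  smul_commute_central[where s = lami and t = c, OF lami_central]

lemmas ptr_simps =
  ptr_add ptr_diff ptr_minus ptr_mul_leg2 ptr_leg2_mul ptr_mul_mat ptr_mat_mul ptr_R ptr_conj

text \<open>Applied to the last \<open>R\<close> of a product, this splits a two-sided
  \<open>R ** X ** R\<close> into a conjugate and the correction that produces the terms with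
  \<open>c\<close>.\<close>

lemma R_right: "X ** R = X ** Ri + X ** mat lam" for X :: "'a ^ ('n \<times> 'n) ^ ('n \<times> 'n)"
  by (simp add: hecke matrix_distribs)

lemma trq_comm_L:
  assumes "central_L (leg2 Y)" shows "trq Y \<star> L = L ** mat (trq Y)"
proof -
  have "ptr (Ri ** leg2 Y ** R ** leg2 L) = ptr (leg2 L ** (R ** leg2 Y ** Ri))"
    using conj_L_comm[OF assms] by (simp add: matrix_mul_assoc)
  then show ?thesis unfolding ptr_simps by (simp add: scalars)
qed

lemma Theta_J: "trq Theta \<star> J = - (J ** mat (trq Theta))"
proof -
  have "ptr (Ri ** leg2 Theta ** R ** leg2 J) = - ptr (leg2 J ** (R ** leg2 Theta ** Ri))"
    using Th_J by (simp add: matrix_mul_assoc leg2_Theta ptr_minus)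
  then show ?thesis unfolding ptr_simps by (simp add: scalars)
qed

lemma trq_J_J: "trq J \<star> J + J ** mat (trq J) = - (lam \<star> c \<star> (J ** J))"
proof -
  have "ptr (leg2 J ** (R ** leg2 J ** Ri) + leg2 J ** (R ** leg2 J) ** mat lam)
      = - ptr (Ri ** leg2 J ** R ** leg2 J)"
    using J_J by (simp add: matrix_mul_assoc R_right[of "leg2 J ** R ** leg2 J"] ptr_minus)
  then show ?thesis
    unfolding ptr_simps by (simp add: scalars eq_neg_iff_add_eq_0 ac_simps)
qed

text \<open>The Hecke correction contains \<open>w ** J ** Li ** Wbar\<close> and the inhomogeneous
  term of \<open>Th_w\<close> contains \<open>Li ** Wbar\<close>; their common right factor leaves W
  on the left.\<close>

lemma Theta_w: "trq Theta \<star> w + w ** mat (trq Theta) = - (c \<star> ((mat 1 + lam \<star> (w ** J)) ** Li ** Wbar))"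
proof -
  have "ptr (R ** leg2 Theta ** Ri ** leg2 w)
      = - ptr (leg2 w ** (R ** leg2 Theta ** Ri) + leg2 w ** (R ** leg2 Theta) ** mat lam)
        - ptr (leg2 (Li ** Wbar) ** R)"
    using Th_w
    by (simp add: matrix_mul_assoc R_right[of "leg2 w ** R ** Th"] leg2_Theta leg2_mult leg2_Wbar
        flip: ptr_minus ptr_diff)
  then have "trq Theta \<star> w = - (w ** mat (trq Theta) + lam \<star> c \<star> (w ** Theta)) - c \<star> (Li ** Wbar)"
    unfolding ptr_simps by (simp add: scalars)
  then show ?thesis
    by (simp add: scalars matrix_distribs Theta_def matrix_mul_assoc)
qed

lemma trq_J_w: "trq J \<star> w + w ** mat (trq J)
    = - (c \<star> (mat 1 + lam \<star> (w ** J) + lam \<star> (J ** w)))"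
proof -
  have "ptr (leg2 w ** (R ** leg2 J ** Ri) + leg2 w ** (R ** leg2 J) ** mat lam
      + (R ** leg2 J ** Ri ** leg2 w + (R ** leg2 J) ** mat lam ** leg2 w)) = - ptr R"
    using w_J by (simp add: matrix_mul_assoc R_right[of "leg2 w ** R ** leg2 J"]
        R_right[of "R ** leg2 J"] matrix_distribs flip: ptr_minus)
  then have "w ** mat (trq J) + lam \<star> c \<star> (w ** J) + (trq J \<star> w + lam \<star> c \<star> (J ** w))
    = - (c \<star> mat 1)"
    unfolding ptr_simps by (simp add: scalars smul_mat_one)
  then show ?thesis
    by (simp add: scalars eq_neg_iff_add_eq_0 ac_simps smul_mat_one
        del: minus_add_distrib)
qed

text \<open>Moving past \<open>T\<close> surrounds \<open>J\<close> by \<open>R\<close>,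
  \<open>Li\<close> by \<open>Ri\<close>, and \<open>Wbar\<close> by \<open>R\<close> and
  \<open>Ri\<close>. In \<open>Theta\<close> the inner factors cancel and a pure conjugate remains,
  so there is no correction as in \<open>trq_J_T\<close>.\<close>

lemma Theta_T: "trq Theta \<star> T = T ** mat (trq Theta)"
proof -
  have Li1: "leg1 Li ** leg1 L = mat 1"
    by (simp add: inverse_L leg_mat flip: leg1_mult)
  have "leg1 Li ** leg2 T = leg1 Li ** (leg2 T ** R ** leg2 L ** R) ** Ri ** leg2 Li ** Ri"
    by (simp add: assoc R_Ri)
  also have "\<dots> = (leg1 Li ** leg1 L) ** leg2 T ** Ri ** leg2 Li ** Ri"
    unfolding L_T[symmetric] by (simp add: assoc)
  finally have Li_T: "leg1 Li ** leg2 T = leg2 T ** Ri ** leg2 Li ** Ri"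
    unfolding Li1 by simp
  have "leg1 J ** leg1 w ** leg2 T = (leg1 J ** leg2 T) ** Ri ** leg2 w ** Ri"
    by (simp add: w_T flip: matrix_mul_assoc)
  also have "\<dots> = leg2 T ** R ** leg2 J ** leg2 w ** Ri"
    unfolding J_T by (simp add: assoc)
  finally have "leg1 Wbar ** leg2 T = leg2 T ** R ** Wb ** Ri"
    unfolding Wbar_def Wb_def leg_add leg1_mult leg_mat
    by (simp add: scalars matrix_distribs assoc R_Ri)
  then have "leg1 Theta ** leg2 T = leg1 J ** (leg1 Li ** leg2 T) ** R ** Wb ** Ri"
    by (simp add: Theta_def leg1_mult assoc)
  also have "\<dots> = (leg1 J ** leg2 T) ** Ri ** leg2 Li ** Wb ** Ri"
    unfolding Li_T by (simp add: assoc)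
  also have "\<dots> = leg2 T ** (R ** leg2 Theta ** Ri)"
    unfolding J_T by (simp add: leg2_Theta Th_def assoc)
  finally have "ptr (leg1 Theta ** leg2 T) = ptr (leg2 T ** (R ** leg2 Theta ** Ri))"
    by simp
  then show ?thesis unfolding ptr_simps ptr_leg1 by (simp add: scalars)
qed

lemma trq_J_T: "trq J \<star> T = T ** mat (trq J) + lam \<star> c \<star> (T ** J)"
proof -
  have "ptr (leg1 J ** leg2 T)
      = ptr (leg2 T ** (R ** leg2 J ** Ri) + leg2 T ** (R ** leg2 J) ** mat lam)"
    using J_T by (simp add: matrix_mul_assoc R_right[of "leg2 T ** R ** leg2 J"])
  then show ?thesis unfolding ptr_simps ptr_leg1 by (simp add: scalars)
qed

lemma mat_Qs: "X ** mat Qs = lami \<star> (X ** mat (trq Theta) - X ** mat (trq J))"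
  by (simp add: vec_eq_iff Qs_def algebra_simps lami_central)

lemma smul_Qs: "Qs \<star> X = lami \<star> (trq Theta \<star> X - trq J \<star> X)"
  by (simp add: Qs_def smul_smul smul_distribs)

lemma Qs_L: "Qs \<star> L - L ** mat Qs = 0"
proof -
  have "central_L (leg2 Theta)" "central_L (leg2 J)"
    by (simp_all add: leg2_Theta central_L_Th L_L J_L)
  then show ?thesis by (simp add: smul_Qs mat_Qs trq_comm_L)
qed

lemma Qs_T: "Qs \<star> T - T ** mat Qs = - (c \<star> (T ** J))"
  by (simp add: smul_Qs mat_Qs Theta_T trq_J_T scalars algebra_simps)

lemma Qs_J: "Qs \<star> J + J ** mat Qs = c \<star> (J ** J)"
proof -
  have "Qs \<star> J + J ** mat Qs
      = lami \<star> ((trq Theta \<star> J + J ** mat (trq Theta)) - (trq J \<star> J + J ** mat (trq J)))"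
    by (simp add: smul_Qs mat_Qs smul_distribs algebra_simps)
  then show ?thesis unfolding trq_J_J by (simp add: Theta_J scalars)
qed

text \<open>With W and Wbar as the two outer factors, 1 + lambda w J + lambda J w = W Wbar -
  lambda^2 w J J w. This merges the contribution of \<open>trq J\<close> with the term W
  \<open>Li\<close> Wbar of \<open>Theta_w\<close>.\<close>

lemma Qs_w: "Qs \<star> w + w ** mat Qs
    = c \<star> ((mat 1 + lam \<star> (w ** J)) ** (lami \<star> (mat 1 - Li)) ** (mat 1 + lam \<star> (J ** w))
       - lam \<star> (w ** J ** J ** w))"
proof -
  have "Qs \<star> w + w ** mat Qs
      = lami \<star> ((trq Theta \<star> w + w ** mat (trq Theta)) - (trq J \<star> w + w ** mat (trq J)))"
    by (simp add: smul_Qs mat_Qs smul_distribs algebra_simps)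
  then show ?thesis unfolding trq_J_w Theta_w
    by (simp add: scalars matrix_distribs assoc Wbar_def)
qed

lemma Qs_square: "Qs * Qs = 0"
proof -
  \<comment> \<open>The trace of \<open>J\<close> is a sum of diagonal entries with central weights,
    so it is enough to anticommute with each of these entries.\<close>
  have "trq Theta * J $ a $ a = - (J $ a $ a * trq Theta)" for a
    using Theta_J by (simp add: vec_eq_iff)
  then have anti: "trq Theta * trq J = - (trq J * trq Theta)"
    by (simp add: trq_def[of J] sum_distrib_left sum_distrib_right d_left_comm mult.assoc
        flip: sum_negf)
  have "trq Theta * trq Theta = 0" "trq J * trq J = 0"
    using Th_Th[OF L_L] J_J e by (auto intro!: trq_square_zero simp: leg2_Theta)
  then have "(trq Theta - trq J) * (trq Theta - trq J) = 0"
    by (simp add: algebra_simps anti)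
  moreover have "Qs * Qs = lami * lami * ((trq Theta - trq J) * (trq Theta - trq J))"
    unfolding Qs_def by (metis lami_central mult.assoc)
  ultimately show ?thesis by simp
qed

lemma Qs_eq: "Qs = trq (J ** (lami \<star> (Li - mat 1)) + J ** Li ** J ** w)"
proof -
  have "Qs = trq (lami \<star> (Theta - J))"
    by (simp add: Qs_def trq_diff trq_mat_mul flip: mat_mul_eq_smul)
  also have "lami \<star> (Theta - J) = J ** (lami \<star> (Li - mat 1)) + J ** Li ** J ** w"
    by (simp add: Theta_def Wbar_def scalars matrix_distribs matrix_mul_assoc)
  finally show ?thesis .
qed

end

section \<open>The Drinfeld--Jimbo matrix\<close>

text \<open>Column indices on the left of each equation: the simplifier then eliminates them, and
  never meets the looping pair \<open>l = k\<close>, \<open>k = l\<close>.\<close>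

lemma delta_commuted: "delta i j = (if j = i then 1 else 0)"
  by (auto simp: delta_def)

lemma mat_nth_commuted: "mat s $ (a, b) $ (k, l) = (if k = a \<and> l = b then s else 0)"
  by (auto simp: mat_def)

lemma Rhat_nth: "Rhat q $ (a, b) $ (k, l) =
    (if k = b \<and> l = a then if a = b then q else 1 else 0)
    + (if a < b then if k = a \<and> l = b then qlam q else 0 else 0)"
proof -
  have "Rhat q $ (a, b) $ (k, l)
      = (\<Sum>x\<in>UNIV. \<Sum>y\<in>UNIV. if y = a then if x = b then R12 q $ (x, y) $ (k, l) else 0 else 0)"
    unfolding Rhat_def perm12_def matrix_matrix_mult_def sum_UNIV_pair vec_lambda_beta
    by (intro sum.cong refl) (auto simp: delta_def)
  also have "\<dots> = R12 q $ (b, a) $ (k, l)" by simp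
  finally have "Rhat q $ (a, b) $ (k, l) = R12 q $ (b, a) $ (k, l)" .
  then show ?thesis
    by (cases a b rule: linorder_cases)
      (auto simp: R12_def delta_commuted qlam_def less_imp_not_eq less_imp_not_eq2)
qed

lemma Rhat_mul_nth: "(Rhat q ** M) $ (a, b) $ p =
    (if a = b then q else 1) * M $ (b, a) $ p + (if a < b then qlam q else 0) * M $ (a, b) $ p"
proof -
  have "Rhat q $ (a, b) $ (k, l) * M $ (k, l) $ p =
      (if k = b then if l = a then (if a = b then q else 1) * M $ (b, a) $ p else 0 else 0)
      + (if k = a then if l = b then (if a < b then qlam q else 0) * M $ (a, b) $ p else 0 else 0)" for k l
    by (cases a b rule: linorder_cases)
      (auto simp: Rhat_nth less_imp_not_eq less_imp_not_eq2)
  then show ?thesis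
    unfolding matrix_matrix_mult_def by (simp add: sum_UNIV_pair sum.distrib sum_if_fixed)
qed

text \<open>The matrix splits into 1x1 blocks q and, for a < b, 2x2 blocks with rows (lambda, 1) and
  (1, 0); each solves x^2 = lambda x + 1.\<close>

lemma Rhat_inverse_aux:
  assumes "q \<noteq> 0"
  shows "Rhat q ** (Rhat q - mat (qlam q)) = (mat 1 :: complex ^ ('n::{finite,linorder} \<times> 'n) ^ ('n \<times> 'n))"
proof -
  have "(Rhat q ** (Rhat q - mat (qlam q))) $ (a, b) $ (k, l) = mat 1 $ (a, b) $ (k, l)" for a b k l :: 'n
  proof -
    have "q * (q - qlam q) = 1" using assms by (simp add: qlam_def)
    then show ?thesis
      unfolding Rhat_mul_nth
      by (cases a b rule: linorder_cases)
        (auto simp: Rhat_nth mat_nth_commuted less_imp_not_eq less_imp_not_eq2)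
  qed
  then show ?thesis by (simp add: vec_eq_iff)
qed

lemma Rhat_inverse:
  defines "R \<equiv> \<lambda>q. Rhat q :: complex ^ ('n::{finite,linorder} \<times> 'n) ^ ('n \<times> 'n)"
  assumes "q \<noteq> 0"
  shows "R q ** matrix_inv (R q) = mat 1" "matrix_inv (R q) ** R q = mat 1"
    "matrix_inv (R q) = R q - mat (qlam q)"
proof -
  have 1: "R q ** (R q - mat (qlam q)) = mat 1" unfolding R_def by (rule Rhat_inverse_aux[OF assms(2)])
  moreover have "(R q - mat (qlam q)) ** R q = R q ** (R q - mat (qlam q))"
    by (simp add: matrix_distribs) (simp add: vec_eq_iff mult.commute)
  \<comment> \<open>\<open>matrix_inv\<close> is a choice, so a two-sided inverse is exhibited
    before it is identified.\<close>
  ultimately have "\<exists>A. R q ** A = mat 1 \<and> A ** R q = mat 1" by metis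
  then have 2: "R q ** matrix_inv (R q) = mat 1 \<and> matrix_inv (R q) ** R q = mat 1"
    unfolding matrix_inv_def by (rule someI_ex)
  then show "R q ** matrix_inv (R q) = mat 1" "matrix_inv (R q) ** R q = mat 1" by simp_all
  have "matrix_inv (R q) = matrix_inv (R q) ** (R q ** (R q - mat (qlam q)))" by (simp add: 1)
  also have "\<dots> = R q - mat (qlam q)" by (simp only: matrix_mul_assoc 2 matrix_mul_lid)
  finally show "matrix_inv (R q) = R q - mat (qlam q)" .
qed

section \<open>Telescoping sums of the diagonal entries of D^-1\<close>

definition dweight :: "complex \<Rightarrow> 'n::{finite,linorder} \<Rightarrow> complex" where
  "dweight q a = q ^ (2 * card {a<..} + 1)"

lemma qlam_mult: "q \<noteq> 0 \<Longrightarrow> qlam q * q = q\<^sup>2 - 1"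
  by (simp add: qlam_def power2_eq_square algebra_simps)

text \<open>An element with k larger ones contributes q^(2k+2) - q^(2k), so the sum telescopes.
  Counting relative to \<open>S\<close> allows induction: a new minimum leaves the other counts
  unchanged.\<close>

lemma sum_card_greater:
  fixes S :: "'n::linorder set"
  assumes "finite S" "q \<noteq> 0"
  shows "(\<Sum>a\<in>S. qlam q * q ^ (2 * card {x \<in> S. a < x} + 1)) = q ^ (2 * card S) - 1"
  using assms(1)
proof (induction S rule: finite_linorder_min_induct)
  case empty
  then show ?case by simp
next
  case (insert b A)
  have "{x \<in> insert b A. b < x} = A" "b \<notin> A" using insert by auto
  moreover have "{x \<in> insert b A. a < x} = {x \<in> A. a < x}" if "a \<in> A" for a
    using insert that by auto
  ultimately have "(\<Sum>a\<in>insert b A. qlam q * q ^ (2 * card {x \<in> insert b A. a < x} + 1))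
      = qlam q * q ^ (2 * card A + 1) + (q ^ (2 * card A) - 1)"
    using insert by simp
  also have "qlam q * q ^ (2 * card A + 1) = (q\<^sup>2 - 1) * q ^ (2 * card A)"
    using qlam_mult[OF assms(2)] by (metis mult.assoc mult.commute power_add power_one_right)
  finally show ?case
    using insert \<open>b \<notin> A\<close> by (simp add: algebra_simps power_add power2_eq_square)
qed

lemma sum_dweight_greater:
  assumes "q \<noteq> 0"
  shows "qlam q * (\<Sum>a | i < a. dweight q a) = q ^ (2 * card {i<..}) - 1"
    (is "_ * sum _ ?S = _")
proof -
  \<comment> \<open>The indices above \<open>i\<close> form an up-set, so counting inside it agrees
    with counting in the whole type.\<close>
  have "{x \<in> ?S. a < x} = {a<..}" if "a \<in> ?S" for a using that by auto
  then have "qlam q * sum (dweight q) ?S = (\<Sum>a\<in>?S. qlam q * q ^ (2 * card {x \<in> ?S. a < x} + 1))"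
    by (simp add: sum_distrib_left dweight_def)
  then show ?thesis using sum_card_greater[of ?S q] assms by (simp add: greaterThan_def)
qed

lemma sum_dweight_UNIV:
  assumes "q \<noteq> 0"
  shows "qlam q * (\<Sum>a\<in>(UNIV :: 'n::{finite,linorder} set). dweight q a) = q ^ (2 * CARD('n)) - 1"
  using sum_card_greater[of "UNIV :: 'n set" q] assms
  by (simp add: dweight_def sum_distrib_left greaterThan_def)

lemma dweight_eq:
  assumes "q \<noteq> 0"
  shows "qlam q * dweight q i = q ^ (2 * card {i<..}) * (q\<^sup>2 - 1)"
  using qlam_mult[OF assms] by (simp add: dweight_def mult.commute mult.left_commute)

text \<open>The weights below \<open>i\<close>, times lambda, telescope to q^(2N) minus
  \<open>dweight q i * q\<close>, and the diagonal entry q restores the missing term; hence a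
  constant independent of \<open>i\<close>.\<close>

lemma Rhat_contract:
  fixes i j :: "'n::{finite,linorder}"
  assumes "q \<noteq> 0"
  shows "(\<Sum>a\<in>UNIV. dweight q a * Rhat q $ (a, i) $ (a, j))
    = (if i = j then q ^ (2 * CARD('n)) else 0)"
proof (cases "i = j")
  case True
  have "(\<Sum>a\<in>UNIV. dweight q a * Rhat q $ (a, i) $ (a, i))
      = (\<Sum>a\<in>UNIV. (if a = i then dweight q a * q else 0) + (if a < i then qlam q * dweight q a else 0))"
    by (intro sum.cong refl) (auto simp: Rhat_nth)
  also have "\<dots> = dweight q i * q + qlam q * (\<Sum>a | a < i. dweight q a)"
    by (simp add: sum.distrib sum.If_cases sum_distrib_left)
  also have "(\<Sum>a | a < i. dweight q a)
      = (\<Sum>a\<in>(UNIV :: 'n set). dweight q a) - (\<Sum>a | i < a. dweight q a) - dweight q i"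
  proof -
    have U: "UNIV = {a. a < i} \<union> ({a. i < a} \<union> {i})" by auto
    have "sum (dweight q) (UNIV :: 'n set) = sum (dweight q) {a. a < i} + (sum (dweight q) {a. i < a} + dweight q i)"
      unfolding U by (subst sum.union_disjoint; auto)+
    then show ?thesis by simp
  qed
  also have "dweight q i * q + qlam q * ((\<Sum>a\<in>(UNIV :: 'n set). dweight q a)
        - (\<Sum>a | i < a. dweight q a) - dweight q i) = dweight q i * q
      + (qlam q * (\<Sum>a\<in>(UNIV :: 'n set). dweight q a) - qlam q * (\<Sum>a | i < a. dweight q a)
        - qlam q * dweight q i)"
    by (simp add: right_diff_distrib)
  also have "\<dots> = q ^ (2 * CARD('n))"
    unfolding sum_dweight_UNIV[OF assms] sum_dweight_greater[OF assms] dweight_eq[OF assms]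
    by (simp add: dweight_def algebra_simps power2_eq_square)
  finally show ?thesis using True by simp
next
  case False
  then show ?thesis by (auto simp: Rhat_nth intro!: sum.neutral)
qed

text \<open>The two boundary terms are those that must cancel in \<open>Rhat_skew1\<close> and
  \<open>Rhat_skew2\<close>.\<close>

lemma sum_dweight_between:
  fixes m i :: "'n::{finite,linorder}"
  assumes "q \<noteq> 0" "m < i"
  shows "qlam q * (\<Sum>a | m < a \<and> a < i. dweight q a) = dweight q m / q - dweight q i * q"
proof -
  have "{a. m < a} = {a. m < a \<and> a < i} \<union> ({a. i < a} \<union> {i})" using assms(2) by auto
  then have "sum (dweight q) {a. m < a} = sum (dweight q) ({a. m < a \<and> a < i} \<union> ({a. i < a} \<union> {i}))" by simp
  also have "\<dots> = sum (dweight q) {a. m < a \<and> a < i} + (sum (dweight q) {a. i < a} + dweight q i)"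
    by (subst sum.union_disjoint; auto)+
  finally have "qlam q * sum (dweight q) {a. m < a \<and> a < i}
     = qlam q * sum (dweight q) {a. m < a} - qlam q * sum (dweight q) {a. i < a} - qlam q * dweight q i"
    by (simp add: algebra_simps)
  then show ?thesis
    using assms(1) unfolding sum_dweight_greater[OF assms(1)] dweight_eq[OF assms(1)]
    by (simp add: algebra_simps dweight_def power2_eq_square)
qed

lemma Rhat_inv_nth:
  assumes "q \<noteq> 0"
  shows "(Rhat q - mat (qlam q)) $ (a, b) $ (k, l) =
    (if k = b \<and> l = a then if a = b then 1 / q else 1 else 0)
    - (if b < a then if k = a \<and> l = b then qlam q else 0 else 0)"
proof -
  have "q - qlam q = 1 / q" using assms by (simp add: qlam_def field_simps)
  then show ?thesis
    by (cases a b rule: linorder_cases)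
      (auto simp: Rhat_nth mat_nth_commuted less_imp_not_eq less_imp_not_eq2)
qed

lemma Rhat_row_sum:
  "(\<Sum>k\<in>UNIV. Rhat q $ (a, i) $ (k, l) * f k) =
    (if a = l then (if a = i then q else 1) * f i else 0)
    + (if a < i then if l = i then qlam q * f a else 0 else 0)"
proof -
  have "(\<Sum>k\<in>UNIV. Rhat q $ (a, i) $ (k, l) * f k) = (\<Sum>k\<in>UNIV.
      (if k = i then if a = l then (if a = i then q else 1) * f i else 0 else 0)
      + (if k = a then if a < i then if l = i then qlam q * f a else 0 else 0 else 0))"
    unfolding Rhat_nth by (intro sum.cong refl) (simp add: distrib_right)
  then show ?thesis by (simp add: sum.distrib)
qed

lemma Rhat_inv_row_sum:
  assumes "q \<noteq> 0"
  shows "(\<Sum>k\<in>UNIV. (Rhat q - mat (qlam q)) $ (a, i) $ (k, l) * f k) =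
    (if a = l then (if a = i then 1 / q else 1) * f i else 0)
    - (if i < a then if l = i then qlam q * f a else 0 else 0)"
proof -
  have "(\<Sum>k\<in>UNIV. (Rhat q - mat (qlam q)) $ (a, i) $ (k, l) * f k) = (\<Sum>k\<in>UNIV.
      (if k = i then if a = l then (if a = i then 1 / q else 1) * f i else 0 else 0)
      - (if k = a then if i < a then if l = i then qlam q * f a else 0 else 0 else 0))"
    unfolding Rhat_inv_nth[OF assms] by (intro sum.cong refl) (simp add: left_diff_distrib)
  then show ?thesis by (simp add: sum_subtractf)
qed

text \<open>Summing over \<open>k\<close> leaves a flip term and, for \<open>l = i\<close>, a sum
  over \<open>a < i\<close> with a factor lambda. In that sum the diagonal part and the telescoped
  lambda^2 part combine to \<open>qlam q * (dweight q i * q)\<close>, which cancels the lambda part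
  of the flip term.\<close>

lemma Rhat_skew1:
  fixes i j l m :: "'n::{finite,linorder}"
  assumes "q \<noteq> 0"
  shows "(\<Sum>a\<in>UNIV. \<Sum>k\<in>UNIV. dweight q a *
        (Rhat q $ (a, i) $ (k, l) * (Rhat q - mat (qlam q)) $ (k, m) $ (a, j)))
      = (if i = j \<and> l = m then dweight q l else 0)"
proof -
  define P :: "complex ^ ('n \<times> 'n) ^ ('n \<times> 'n)" where "P = Rhat q - mat (qlam q)"
  have diag: "P $ (a, m) $ (a, j) = (if j = m then (if a = m then 1 / q else 0) - (if m < a then qlam q else 0) else 0)" for a
    unfolding P_def Rhat_inv_nth[OF assms] by auto
  have "(\<Sum>a\<in>UNIV. if a < i then dweight q a * (qlam q * P $ (a, m) $ (a, j)) else 0)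
      = (if j = m then \<Sum>a\<in>UNIV. (if a = m then if m < i then qlam q * dweight q m / q else 0 else 0)
          - (if m < a \<and> a < i then qlam q * (qlam q * dweight q a) else 0) else 0)"
    unfolding diag by (cases "j = m") (auto intro!: sum.cong sum.neutral)
  also have "\<dots> = (if j = m then (if m < i then qlam q * dweight q m / q else 0)
      - qlam q * (qlam q * (\<Sum>a | m < a \<and> a < i. dweight q a)) else 0)"
    by (simp add: sum_subtractf sum.If_cases sum_distrib_left)
  also have "\<dots> = (if j = m then if m < i then qlam q * (dweight q i * q) else 0 else 0)"
  proof (cases "m < i")
    case False
    then have E: "{a. m < a \<and> a < i} = {}" by auto
    show ?thesis unfolding E using False by simp
  qed (simp add: sum_dweight_between[OF assms] algebra_simps)
  finally have *: "(\<Sum>a\<in>UNIV. if a < i then dweight q a * (qlam q * P $ (a, m) $ (a, j)) else 0)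
    = (if j = m then if m < i then qlam q * (dweight q i * q) else 0 else 0)" .
  have "(\<Sum>a\<in>UNIV. \<Sum>k\<in>UNIV. dweight q a * (Rhat q $ (a, i) $ (k, l) * P $ (k, m) $ (a, j)))
      = (\<Sum>a\<in>UNIV. dweight q a * (\<Sum>k\<in>UNIV. Rhat q $ (a, i) $ (k, l) * P $ (k, m) $ (a, j)))"
    by (simp only: sum_distrib_left)
  also have "\<dots> = (\<Sum>a\<in>UNIV. (if a = l then dweight q l * ((if l = i then q else 1) * P $ (i, m) $ (l, j)) else 0)
     + (if l = i then if a < i then dweight q a * (qlam q * P $ (a, m) $ (a, j)) else 0 else 0))"
    unfolding Rhat_row_sum by (intro sum.cong refl) (simp add: distrib_left)
  also have "\<dots> = dweight q l * ((if l = i then q else 1) * P $ (i, m) $ (l, j))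
     + (if l = i then if j = m then if m < i then qlam q * (dweight q i * q) else 0 else 0 else 0)"
    by (simp add: sum.distrib sum_if_fixed *)
  also have "\<dots> = (if i = j \<and> l = m then dweight q l else 0)"
    using assms unfolding P_def Rhat_inv_nth[OF assms]
    by (cases m i rule: linorder_cases)
      (auto simp: less_imp_not_eq less_imp_not_eq2)
  finally show ?thesis unfolding P_def .
qed

text \<open>Same cancellation with the two factors exchanged: here
  \<open>qlam q * (dweight q i / q)\<close> is what remains of the sum.\<close>

lemma Rhat_skew2:
  fixes i j l m :: "'n::{finite,linorder}"
  assumes "q \<noteq> 0"
  shows "(\<Sum>a\<in>UNIV. \<Sum>k\<in>UNIV. dweight q a *
        ((Rhat q - mat (qlam q)) $ (a, i) $ (k, l) * Rhat q $ (k, m) $ (a, j)))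
      = (if i = j \<and> l = m then dweight q l else 0)"
proof -
  define P :: "complex ^ ('n \<times> 'n) ^ ('n \<times> 'n)" where "P = Rhat q - mat (qlam q)"
  have diag: "Rhat q $ (a, m) $ (a, j) = (if j = m then (if a = m then q else 0) + (if a < m then qlam q else 0) else 0)" for a
    unfolding Rhat_nth by auto
  have "(\<Sum>a\<in>UNIV. if i < a then dweight q a * (qlam q * Rhat q $ (a, m) $ (a, j)) else 0)
      = (if j = m then \<Sum>a\<in>UNIV. (if a = m then if i < m then qlam q * dweight q m * q else 0 else 0)
          + (if i < a \<and> a < m then qlam q * (qlam q * dweight q a) else 0) else 0)"
    unfolding diag by (cases "j = m") (auto intro!: sum.cong sum.neutral)
  also have "\<dots> = (if j = m then (if i < m then qlam q * dweight q m * q else 0)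
      + qlam q * (qlam q * (\<Sum>a | i < a \<and> a < m. dweight q a)) else 0)"
    by (simp add: sum.distrib sum.If_cases sum_distrib_left)
  also have "\<dots> = (if j = m then if i < m then qlam q * (dweight q i / q) else 0 else 0)"
  proof (cases "i < m")
    case False
    then have E: "{a. i < a \<and> a < m} = {}" by auto
    show ?thesis unfolding E using False by simp
  qed (simp add: sum_dweight_between[OF assms] algebra_simps)
  finally have *: "(\<Sum>a\<in>UNIV. if i < a then dweight q a * (qlam q * Rhat q $ (a, m) $ (a, j)) else 0)
    = (if j = m then if i < m then qlam q * (dweight q i / q) else 0 else 0)" .
  have "(\<Sum>a\<in>UNIV. \<Sum>k\<in>UNIV. dweight q a * (P $ (a, i) $ (k, l) * Rhat q $ (k, m) $ (a, j)))
      = (\<Sum>a\<in>UNIV. dweight q a * (\<Sum>k\<in>UNIV. P $ (a, i) $ (k, l) * Rhat q $ (k, m) $ (a, j)))"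
    by (simp only: sum_distrib_left)
  also have "\<dots> = (\<Sum>a\<in>UNIV. (if a = l then dweight q l * ((if l = i then 1 / q else 1) * Rhat q $ (i, m) $ (l, j)) else 0)
     - (if l = i then if i < a then dweight q a * (qlam q * Rhat q $ (a, m) $ (a, j)) else 0 else 0))"
    unfolding P_def Rhat_inv_row_sum[OF assms] by (intro sum.cong refl) (simp add: right_diff_distrib)
  also have "\<dots> = dweight q l * ((if l = i then 1 / q else 1) * Rhat q $ (i, m) $ (l, j))
     - (if l = i then if j = m then if i < m then qlam q * (dweight q i / q) else 0 else 0 else 0)"
    by (simp add: sum_subtractf sum_if_fixed *)
  also have "\<dots> = (if i = j \<and> l = m then dweight q l else 0)"
    using assms by (cases m i rule: linorder_cases)
      (auto simp: Rhat_nth less_imp_not_eq less_imp_not_eq2)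
  finally show ?thesis unfolding P_def .
qed

text \<open>Nonzero entries occur only where the column pair is a permutation of the row
  pair.\<close>

lemma Rhat_weight: "dweight q a * dweight q b * Rhat q $ (a, b) $ (k, l)
    = dweight q k * dweight q l * Rhat q $ (a, b) $ (k, l)"
  by (cases a b rule: linorder_cases)
    (auto simp: Rhat_nth less_imp_not_eq less_imp_not_eq2)

section \<open>The differential algebra as a ring\<close>

lemma ideal_add: "x \<in> two_sided_ideal S \<Longrightarrow> y \<in> two_sided_ideal S \<Longrightarrow> x + y \<in> two_sided_ideal S"
proof (rotate_tac, induction y rule: two_sided_ideal.induct)
  case (add y s a b)
  then show ?case using two_sided_ideal.add[of "x + y" S s a b] by (simp add: add.assoc)
qed simp

lemma ideal_mult_left: "x \<in> two_sided_ideal S \<Longrightarrow> c * x \<in> two_sided_ideal S"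
proof (induction x rule: two_sided_ideal.induct)
  case (add x s a b)
  then show ?case using two_sided_ideal.add[of "c * x" S s "c * a" b]
    by (simp add: distrib_left mult.assoc)
qed (simp add: two_sided_ideal.zero)

lemma ideal_mult_right: "x \<in> two_sided_ideal S \<Longrightarrow> x * c \<in> two_sided_ideal S"
proof (induction x rule: two_sided_ideal.induct)
  case (add x s a b)
  then show ?case using two_sided_ideal.add[of "x * c" S s a "b * c"]
    by (simp add: distrib_right mult.assoc)
qed (simp add: two_sided_ideal.zero)

lemma ideal_minus: "x \<in> two_sided_ideal S \<Longrightarrow> - x \<in> two_sided_ideal S"
  using ideal_mult_left[of x S "- 1"] by simp

lemma ideal_generator: "s \<in> S \<Longrightarrow> s \<in> two_sided_ideal S"
  using two_sided_ideal.add[OF two_sided_ideal.zero, of s S 1 1] by simp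

lemma diff_eq_refl: "diff_eq q x x"
  by (simp add: diff_eq_def two_sided_ideal.zero)

lemma diff_eq_sym: "diff_eq q x y \<Longrightarrow> diff_eq q y x"
  unfolding diff_eq_def using ideal_minus by fastforce

lemma diff_eq_trans: "diff_eq q x y \<Longrightarrow> diff_eq q y z \<Longrightarrow> diff_eq q x z"
  unfolding diff_eq_def using ideal_add[of "x - y" _ "y - z"] by simp

lemma diff_eq_add: "diff_eq q x y \<Longrightarrow> diff_eq q x' y' \<Longrightarrow> diff_eq q (x + x') (y + y')"
  unfolding diff_eq_def using ideal_add[of "x - y" _ "x' - y'"] by (simp add: algebra_simps)

lemma diff_eq_minus: "diff_eq q x y \<Longrightarrow> diff_eq q (- x) (- y)"
  unfolding diff_eq_def using ideal_minus[of "x - y"] by simp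

lemma diff_eq_diff: "diff_eq q x y \<Longrightarrow> diff_eq q x' y' \<Longrightarrow> diff_eq q (x - x') (y - y')"
  using diff_eq_add[of q x y "- x'" "- y'"] diff_eq_minus[of q x' y'] by simp

lemma diff_eq_mult: "diff_eq q x y \<Longrightarrow> diff_eq q x' y' \<Longrightarrow> diff_eq q (x * x') (y * y')"
  unfolding diff_eq_def
  using ideal_add[OF ideal_mult_right[of "x - y" _ x'] ideal_mult_left[of "x' - y'" _ y]]
  by (simp add: algebra_simps)

text \<open>The last clause excludes parameters with zero algebra, where every congruence holds
  trivially; it is what yields \<open>0 \<noteq> 1\<close> in the quotient.\<close>

definition nondegenerate :: "'n::{finite,linorder} itself \<Rightarrow> complex \<Rightarrow> bool" where
  "nondegenerate _ q \<longleftrightarrow> q \<noteq> 0 \<and> qlam q \<noteq> 0 \<and> q\<^sup>2 \<noteq> -1 \<and> \<not> diff_eq q (1 :: 'n dgen free_alg) 0"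

text \<open>A type cannot depend on the parameter \<open>q\<close>; so the quotient is taken for all \<open>q\<close> at once,
  which gives the product over \<open>q\<close> of the differential algebras.  The second branch of the
  conditional never arises in the application; it secures \<open>0 \<noteq> 1\<close>, an axiom of class
  \<open>ring_1\<close>, without having to show that some differential algebra is nontrivial.\<close>

definition family_eq ::
  "(complex \<Rightarrow> 'n::{finite,linorder} dgen free_alg) \<Rightarrow> (complex \<Rightarrow> 'n dgen free_alg) \<Rightarrow> bool" where
  "family_eq f g \<longleftrightarrow>
    (if \<exists>q. nondegenerate TYPE('n) q
     then \<forall>q. nondegenerate TYPE('n) q \<longrightarrow> diff_eq q (f q) (g q) else f = g)"

lemma family_eq_refl: "family_eq f f"
  by (simp add: family_eq_def diff_eq_refl)

quotient_type (overloaded) 'n diff_alg = "complex \<Rightarrow> 'n::{finite,linorder} dgen free_alg" / family_eq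
proof (rule equivpI)
  show "reflp family_eq" by (simp add: reflp_def family_eq_refl)
  show "symp family_eq" by (auto simp: symp_def family_eq_def intro: diff_eq_sym)
  show "transp family_eq" by (auto simp: transp_def family_eq_def intro: diff_eq_trans)
qed

instantiation diff_alg :: ("{finite,linorder}") ring_1
begin

lift_definition zero_diff_alg :: "'a diff_alg" is "\<lambda>_. 0" .
lift_definition one_diff_alg :: "'a diff_alg" is "\<lambda>_. 1" .
lift_definition plus_diff_alg :: "'a diff_alg \<Rightarrow> 'a diff_alg \<Rightarrow> 'a diff_alg"
  is "\<lambda>f g q. f q + g q" by (auto simp: family_eq_def diff_eq_add split: if_splits)
lift_definition uminus_diff_alg :: "'a diff_alg \<Rightarrow> 'a diff_alg"
  is "\<lambda>f q. - f q" by (auto simp: family_eq_def diff_eq_minus split: if_splits)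
lift_definition minus_diff_alg :: "'a diff_alg \<Rightarrow> 'a diff_alg \<Rightarrow> 'a diff_alg"
  is "\<lambda>f g q. f q - g q" by (auto simp: family_eq_def diff_eq_diff split: if_splits)
lift_definition times_diff_alg :: "'a diff_alg \<Rightarrow> 'a diff_alg \<Rightarrow> 'a diff_alg"
  is "\<lambda>f g q. f q * g q" by (auto simp: family_eq_def diff_eq_mult split: if_splits)

instance
proof
  show "(0 :: 'a diff_alg) \<noteq> 1"
    by transfer (auto simp: family_eq_def nondegenerate_def fun_eq_iff dest: diff_eq_sym)
qed (transfer; simp add: family_eq_refl algebra_simps)+

end

section \<open>Classes of families of scalars and matrices\<close>

abbreviation cls :: "(complex \<Rightarrow> 'n::{finite,linorder} dgen free_alg) \<Rightarrow> 'n diff_alg" where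
  "cls \<equiv> abs_diff_alg"

definition mcls :: "(complex \<Rightarrow> 'n::{finite,linorder} dgen free_alg ^ 'c ^ 'r) \<Rightarrow> 'n diff_alg ^ 'c ^ 'r" where
  "mcls A = (\<chi> i j. cls (\<lambda>q. A q $ i $ j))"

text \<open>A whole function of q becomes one central ring element, so \<open>qlam\<close> and
  q^(2N) can serve as the constants of the locales.\<close>

definition qscal :: "(complex \<Rightarrow> complex) \<Rightarrow> 'n::{finite,linorder} diff_alg" where
  "qscal f = cls (\<lambda>q. scal (f q))"

lemma cls_eqD:
  assumes "cls f = cls g" "nondegenerate TYPE('n) q"
  shows "diff_eq q (f q) (g q :: 'n::{finite,linorder} dgen free_alg)"
  using assms by (auto simp: diff_alg.abs_eq_iff family_eq_def split: if_splits)

lemma cls_eqI: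
  assumes "\<exists>q. nondegenerate TYPE('n::{finite,linorder}) q" "\<And>q. nondegenerate TYPE('n) q \<Longrightarrow> diff_eq q (f q) (g q)"
  shows "cls f = (cls g :: 'n::{finite,linorder} diff_alg)"
  using assms by (auto simp: diff_alg.abs_eq_iff family_eq_def)

lemmas cls_simps =
  plus_diff_alg.abs_eq minus_diff_alg.abs_eq uminus_diff_alg.abs_eq times_diff_alg.abs_eq
  zero_diff_alg.abs_eq one_diff_alg.abs_eq

lemma cls_sum: "cls (\<lambda>q. \<Sum>i\<in>I. f i q) = (\<Sum>i\<in>I. cls (f i))"
  by (induction I rule: infinite_finite_induct) (simp_all add: cls_simps flip: cls_simps(1))

lemma mcls_simps:
  "mcls (\<lambda>q. A q + B q) = mcls A + mcls B"
  "mcls (\<lambda>q. A q - B q) = mcls A - mcls B"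
  "mcls (\<lambda>q. - A q) = - mcls A"
  "mcls (\<lambda>q. mat 1) = mat 1"
  "mcls (\<lambda>q. 0) = 0"
  by (simp_all add: mcls_def vec_eq_iff cls_simps mat_def)

lemma mcls_mult: "mcls (\<lambda>q. A q ** B q) = mcls A ** mcls B"
  by (simp add: mcls_def vec_eq_iff cls_simps matrix_matrix_mult_def cls_sum)

lemma mcls_leg: "mcls (\<lambda>q. leg1 (Y q)) = leg1 (mcls Y)" "mcls (\<lambda>q. leg2 (Y q)) = leg2 (mcls Y)"
  by (simp_all add: mcls_def vec_eq_iff cls_simps leg1_def leg2_def)

lemma mcls_smult: "mcls (\<lambda>q. f q \<odot> A q) = qscal f \<star> mcls A"
  by (simp add: mcls_def vec_eq_iff cls_simps smult_mat_def qscal_def)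

lemma scal_add: "scal (a + b) = scal a + scal b"
  and scal_mult: "scal (a * b) = scal a * scal b"
  and scal_simps: "scal 0 = 0" "scal 1 = 1" "scal (- a) = - scal a" "scal (a - b) = scal a - scal b"
  by (simp_all add: scal_def single_add mult_single single_uminus single_diff)

lemma scal_sum: "scal (\<Sum>i\<in>I. f i) = (\<Sum>i\<in>I. scal (f i))"
  by (induction I rule: infinite_finite_induct) (simp_all add: scal_add scal_simps)

lemma scal_central: "scal a * x = x * scal a"
proof (induction x rule: update_induct)
  case (update f k v)
  \<comment> \<open>\<open>k\<close> is not yet a key of \<open>f\<close>, so updating adds a
    monomial.\<close>
  then have "Poly_Mapping.update k v f = f + Poly_Mapping.single k v"
    by (intro poly_mapping_eqI)
      (auto simp: lookup_update lookup_add lookup_single when_def in_keys_iff)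
  then show ?case
    using update.IH by (simp add: distrib_left distrib_right scal_def mult_single mult.commute)
qed simp

lemma qscal_simps:
  "qscal (\<lambda>q. f q + g q) = qscal f + qscal g" "qscal (\<lambda>q. f q * g q) = qscal f * qscal g"
  "qscal (\<lambda>q. f q - g q) = qscal f - qscal g" "qscal (\<lambda>q. - f q) = - qscal f"
  "qscal (\<lambda>q. 1) = 1" "qscal (\<lambda>q. 0) = 0"
  by (simp_all add: qscal_def scal_add scal_mult scal_simps cls_simps)

lemma qscal_sum: "qscal (\<lambda>q. \<Sum>i\<in>I. f i q) = (\<Sum>i\<in>I. qscal (f i))"
  by (simp add: qscal_def scal_sum cls_sum)

lemma qscal_numeral: "qscal (\<lambda>q. numeral n) = numeral n"
proof -
  have "qscal (\<lambda>q. of_nat k) = of_nat k" for k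
    by (induction k) (simp_all add: qscal_simps)
  from this[of "numeral n"] show ?thesis by simp
qed

lemma qscal_central: "qscal f * x = x * qscal f"
  by (induction x rule: diff_alg.abs_induct) (simp add: qscal_def cls_simps scal_central)

text \<open>Only nondegenerate parameters are compared, so \<open>1 / qlam q\<close> gives a true
  inverse although elsewhere the division may be by zero.\<close>

lemma qscal_eqI:
  assumes "\<exists>q. nondegenerate TYPE('n::{finite,linorder}) q" "\<And>q. nondegenerate TYPE('n) q \<Longrightarrow> f q = g q"
  shows "qscal f = (qscal g :: 'n::{finite,linorder} diff_alg)"
  unfolding qscal_def by (rule cls_eqI) (use assms in \<open>simp_all add: diff_eq_refl\<close>)

lemma mcls_cmat_nth: "mcls (\<lambda>q. cmat (A q)) $ i $ j = qscal (\<lambda>q. A q $ i $ j)"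
  by (simp add: mcls_def cmat_def qscal_def)

lemma mcls_cmat_eqI:
  assumes "\<exists>q. nondegenerate TYPE('n::{finite,linorder}) q" "\<And>q. nondegenerate TYPE('n::{finite,linorder}) q \<Longrightarrow> A q = B q"
  shows "mcls (\<lambda>q. cmat (A q)) = (mcls (\<lambda>q. cmat (B q)) :: 'n::{finite,linorder} diff_alg ^ 'c ^ 'r)"
  using assms by (auto simp: vec_eq_iff mcls_cmat_nth intro!: qscal_eqI)

lemma mcls_cmat_mult: "mcls (\<lambda>q. cmat (A q ** B q)) = mcls (\<lambda>q. cmat (A q)) ** mcls (\<lambda>q. cmat (B q))"
  by (simp add: vec_eq_iff mcls_cmat_nth matrix_matrix_mult_def qscal_sum qscal_simps)

lemma mcls_cmat_mat: "mcls (\<lambda>q. cmat (mat (f q))) = mat (qscal f)"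
  by (simp add: vec_eq_iff mcls_cmat_nth mat_def qscal_simps)

lemma mcls_cmat_add: "mcls (\<lambda>q. cmat (A q + B q)) = mcls (\<lambda>q. cmat (A q)) + mcls (\<lambda>q. cmat (B q))"
  by (simp add: vec_eq_iff mcls_cmat_nth qscal_simps)

lemma mcls_eqD:
  assumes "mcls A = mcls B" "nondegenerate TYPE('n::{finite,linorder}) q"
  shows "diff_eq_mat q (A q) (B q :: 'n::{finite,linorder} dgen free_alg ^ 'n::{finite,linorder} ^ 'n::{finite,linorder})"
  using assms cls_eqD[where q = q] by (fastforce simp: diff_eq_mat_def mcls_def vec_eq_iff)

lemma relation_mcls:
  assumes "\<exists>q. nondegenerate TYPE('n::{finite,linorder}) q"
    and "\<And>q. entries (A q - B q) \<subseteq> diff_relations q"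
  shows "mcls A = (mcls B :: 'n::{finite,linorder} diff_alg ^ 'c ^ 'r)"
proof -
  have "diff_eq q (A q $ i $ j) (B q $ i $ j)" for q i j
  proof -
    have "A q $ i $ j - B q $ i $ j \<in> entries (A q - B q)"
      unfolding entries_def by force
    then show ?thesis unfolding diff_eq_def using assms(2) by (blast intro: ideal_generator)
  qed
  then show ?thesis
    using assms(1) by (auto simp: mcls_def vec_eq_iff intro!: cls_eqI)
qed

lemma Trq_eq: "Trq q Y = (\<Sum>a\<in>UNIV. scal (dweight q a) * Y $ a $ a)"
proof -
  have "scal (Dinv q $ a $ k) * Y $ k $ a = (if k = a then scal (dweight q a) * Y $ a $ a else 0)" for a k
    by (simp add: Dinv_def dweight_def delta_commuted scal_simps)
  then show ?thesis
    by (simp add: Trq_def trace_def matrix_matrix_mult_def cmat_def)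
qed

lemma anti_brst_diff_alg:
  assumes ex: "\<exists>q. nondegenerate TYPE('n::{finite,linorder}) q"
  shows "anti_brst (mcls (\<lambda>q. cmat (Rhat q))) (mcls (\<lambda>q. cmat (matrix_inv (Rhat q))))
    (\<lambda>a. qscal (\<lambda>q. dweight q a)) (qscal qlam) (qscal (\<lambda>q. q ^ (2 * CARD('n))))
    (qscal (\<lambda>q. 1 / qlam q)) (qscal (\<lambda>q. 1 / (4 + qlam q * qlam q)))
    (mcls (\<lambda>q. matT)) (mcls (\<lambda>q. matOmega)) (mcls (\<lambda>q. matL)) (mcls (\<lambda>q. matLinv))
    (mcls (\<lambda>q. matJ :: 'n dgen free_alg ^ 'n::{finite,linorder} ^ 'n::{finite,linorder}))"
proof -
  \<comment> \<open>With the union unfolded, each defining relation becomes a set inclusion.\<close>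
  note rel = relation_mcls[OF ex, unfolded diff_relations_def Let_def]
  note push = mcls_mult mcls_simps mcls_leg
  have nz: "q \<noteq> 0" if "nondegenerate TYPE('n) q" for q
    using that by (simp add: nondegenerate_def)
  \<comment> \<open>Conditionals have to move inside \<open>qscal\<close> before an equation can be
    checked pointwise in q.\<close>
  have pull: "(if P then qscal f else 0) = qscal (\<lambda>q. if P then f q else 0)" for P and f :: "complex \<Rightarrow> complex"
    by (simp add: qscal_simps)
  show ?thesis
  proof unfold_locales
    fix x :: "'n diff_alg" and i j
    show "mcls (\<lambda>q. cmat (Rhat q)) $ i $ j * x = x * mcls (\<lambda>q. cmat (Rhat q)) $ i $ j"
      unfolding mcls_cmat_nth by (rule qscal_central)
  next
    show "mcls (\<lambda>q. cmat (Rhat q)) ** mcls (\<lambda>q. cmat (matrix_inv (Rhat q))) = mat (1 :: 'n diff_alg)"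
      unfolding mcls_cmat_mult[symmetric] qscal_simps(5)[symmetric] mcls_cmat_mat[symmetric]
      by (rule mcls_cmat_eqI[OF ex]) (rule Rhat_inverse nz, assumption?)+
    show "mcls (\<lambda>q. cmat (matrix_inv (Rhat q))) ** mcls (\<lambda>q. cmat (Rhat q)) = mat (1 :: 'n diff_alg)"
      unfolding mcls_cmat_mult[symmetric] qscal_simps(5)[symmetric] mcls_cmat_mat[symmetric]
      by (rule mcls_cmat_eqI[OF ex]) (rule Rhat_inverse nz, assumption?)+
    show "mcls (\<lambda>q. cmat (Rhat q)) = mcls (\<lambda>q. cmat (matrix_inv (Rhat q))) + mat (qscal qlam :: 'n diff_alg)"
      unfolding mcls_cmat_mat[symmetric] mcls_cmat_add[symmetric]
      by (rule mcls_cmat_eqI[OF ex]) (simp add: Rhat_inverse(3) nz)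
  next
    fix i j l m :: 'n
    show "(\<Sum>a\<in>UNIV. \<Sum>k\<in>UNIV. qscal (\<lambda>q. dweight q a) * (mcls (\<lambda>q. cmat (Rhat q)) $ (a, i) $ (k, l)
        * mcls (\<lambda>q. cmat (matrix_inv (Rhat q))) $ (k, m) $ (a, j)))
      = (if i = j \<and> l = m then qscal (\<lambda>q. dweight q l) else (0 :: 'n diff_alg))"
      unfolding mcls_cmat_nth pull qscal_simps(2)[symmetric] qscal_sum[symmetric]
      by (rule qscal_eqI[OF ex]) (simp only: Rhat_inverse(3) nz Rhat_skew1 not_False_eq_True)
    show "(\<Sum>a\<in>UNIV. \<Sum>k\<in>UNIV. qscal (\<lambda>q. dweight q a) * (mcls (\<lambda>q. cmat (matrix_inv (Rhat q))) $ (a, i) $ (k, l)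
        * mcls (\<lambda>q. cmat (Rhat q)) $ (k, m) $ (a, j)))
      = (if i = j \<and> l = m then qscal (\<lambda>q. dweight q l) else (0 :: 'n diff_alg))"
      unfolding mcls_cmat_nth pull qscal_simps(2)[symmetric] qscal_sum[symmetric]
      by (rule qscal_eqI[OF ex]) (simp only: Rhat_inverse(3) nz Rhat_skew2 not_False_eq_True)
  next
    fix i j :: 'n
    show "(\<Sum>a\<in>UNIV. qscal (\<lambda>q. dweight q a) * mcls (\<lambda>q. cmat (Rhat q)) $ (a, i) $ (a, j))
      = (if i = j then qscal (\<lambda>q. q ^ (2 * CARD('n))) else (0 :: 'n diff_alg))"
      unfolding mcls_cmat_nth pull qscal_simps(2)[symmetric] qscal_sum[symmetric]
      by (rule qscal_eqI[OF ex]) (simp only: nz Rhat_contract not_False_eq_True)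
  next
    fix a b k l :: 'n
    show "qscal (\<lambda>q. dweight q a) * qscal (\<lambda>q. dweight q b) * mcls (\<lambda>q. cmat (Rhat q)) $ (a, b) $ (k, l)
      = qscal (\<lambda>q. dweight q k) * qscal (\<lambda>q. dweight q l)
        * (mcls (\<lambda>q. cmat (Rhat q)) $ (a, b) $ (k, l) :: 'n diff_alg)"
      unfolding mcls_cmat_nth qscal_simps(2)[symmetric] by (subst Rhat_weight) (rule refl)
  next
    show "qscal qlam * qscal (\<lambda>q. 1 / qlam q) = (1 :: 'n diff_alg)"
      unfolding qscal_simps(2,5)[symmetric]
      by (rule qscal_eqI[OF ex]) (simp add: nondegenerate_def)
    have "4 + qlam q * qlam q \<noteq> 0" if "nondegenerate TYPE('n) q" for q
    proof
      assume "4 + qlam q * qlam q = 0"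
      \<comment> \<open>The product is q^2 (4 + lambda^2).\<close>
      then have "(q\<^sup>2 + 1) * (q\<^sup>2 + 1) = 0"
        using nz[OF that] by (simp add: qlam_def field_simps power2_eq_square)
      then show False using that by (simp add: nondegenerate_def eq_neg_iff_add_eq_0)
    qed
    then show "qscal (\<lambda>q. 1 / (4 + qlam q * qlam q)) * (4 + qscal qlam * qscal qlam) = (1 :: 'n diff_alg)"
      unfolding qscal_simps(1,2,5)[symmetric] qscal_numeral[symmetric]
      by (intro qscal_eqI[OF ex]) simp
  next
    show "mcls (\<lambda>q. matL) ** mcls (\<lambda>q. matLinv) = mat (1 :: 'n diff_alg)"
      unfolding push[symmetric] by (rule rel) blast
    show "mcls (\<lambda>q. matLinv) ** mcls (\<lambda>q. matL) = mat (1 :: 'n diff_alg)"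
      unfolding push[symmetric] by (rule rel) blast
  next
    let ?R = "mcls (\<lambda>q. cmat (Rhat q)) :: 'n diff_alg ^ ('n::{finite,linorder} \<times> 'n) ^ ('n \<times> 'n)"
    let ?Ri = "mcls (\<lambda>q. cmat (matrix_inv (Rhat q))) :: 'n diff_alg ^ ('n::{finite,linorder} \<times> 'n) ^ ('n \<times> 'n)"
    let ?T = "mcls (\<lambda>q. matT) :: 'n diff_alg ^ 'n::{finite,linorder} ^ 'n::{finite,linorder}"
    let ?w = "mcls (\<lambda>q. matOmega) :: 'n diff_alg ^ 'n::{finite,linorder} ^ 'n::{finite,linorder}"
    let ?L = "mcls (\<lambda>q. matL) :: 'n diff_alg ^ 'n::{finite,linorder} ^ 'n::{finite,linorder}"
    let ?J = "mcls (\<lambda>q. matJ) :: 'n diff_alg ^ 'n::{finite,linorder} ^ 'n::{finite,linorder}"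
    show "leg2 ?w ** ?Ri ** leg2 ?w ** ?R = - (?Ri ** leg2 ?w ** ?Ri ** leg2 ?w)"
      unfolding push[symmetric] by (rule rel) blast
    show "leg2 ?w ** ?R ** leg2 ?L ** ?R = ?R ** leg2 ?L ** ?R ** leg2 ?w"
      unfolding push[symmetric] by (rule rel) blast
    show "leg2 ?w ** ?R ** leg2 ?J ** ?R + ?R ** leg2 ?J ** ?R ** leg2 ?w = - ?R"
      unfolding push[symmetric] by (rule rel) blast
    show "leg2 ?L ** ?R ** leg2 ?L ** ?R = ?R ** leg2 ?L ** ?R ** leg2 ?L"
      unfolding push[symmetric] by (rule rel) blast
    show "leg2 ?J ** ?R ** leg2 ?L ** ?R = ?R ** leg2 ?L ** ?R ** leg2 ?J"
      unfolding push[symmetric] by (rule rel) blast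
    show "leg2 ?J ** ?R ** leg2 ?J ** ?R = - (?Ri ** leg2 ?J ** ?R ** leg2 ?J)"
      unfolding push[symmetric] by (rule rel) blast
    show "leg1 ?w ** leg2 ?T = leg2 ?T ** ?Ri ** leg2 ?w ** ?Ri"
      unfolding push[symmetric] by (rule rel) blast
    show "leg1 ?J ** leg2 ?T = leg2 ?T ** ?R ** leg2 ?J ** ?R"
      unfolding push[symmetric] by (rule rel) blast
    show "leg1 ?L ** leg2 ?T = leg2 ?T ** ?R ** leg2 ?L ** ?R"
      unfolding push[symmetric] by (rule rel) blast
  qed (rule qscal_central)+
qed

lemma diff_eq_degenerate:
  fixes x y :: "'n::{finite,linorder} dgen free_alg"
  assumes "diff_eq q (1 :: 'n dgen free_alg) 0"
  shows "diff_eq q x y"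
  using assms ideal_mult_left[of 1 "diff_relations q" "x - y"]
  by (simp add: diff_eq_def)

theorem mainTheorem4:
  fixes q :: complex
    and Q :: "'n::{finite,linorder} dgen free_alg"
    and N :: nat
  assumes "q \<noteq> 0" and "qlam q \<noteq> 0" and "q\<^sup>2 \<noteq> -1"
    and "N = CARD('n)"
    and "Q = Qstar q"
  shows "diff_eq q Q (scal (1 / qlam q) * (Trq q (Theta_star q) - Trq q matJ))
    \<and> diff_eq q (Q\<^sup>2) 0
    \<and> diff_eq_mat q (commutator_mat Q matL) 0
    \<and> diff_eq_mat q (commutator_mat Q matT) (- (q ^ (2 * N)) \<odot> (matT ** matJ))
    \<and> diff_eq_mat q (anticommutator_mat Q matJ) (q ^ (2 * N) \<odot> (matJ ** matJ))
    \<and> diff_eq_mat q (anticommutator_mat Q matOmega)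
        (q ^ (2 * N) \<odot> (matW q ** ((1 / qlam q) \<odot> (mat 1 - matLinv)) ** matWbar q
                        - qlam q \<odot> (matOmega ** matJ ** matJ ** matOmega)))"
\<comment> \<open>If 1 is congruent to 0, all elements are congruent; otherwise \<open>q\<close>
  witnesses that the quotient ring is not on its fallback branch.\<close>
proof (cases "diff_eq q (1 :: 'n dgen free_alg) 0")
  case True
  then show ?thesis by (simp add: diff_eq_mat_def diff_eq_degenerate)
next
  case False
  then have nd: "nondegenerate TYPE('n) q"
    using assms by (simp add: nondegenerate_def)
  then have ex: "\<exists>q. nondegenerate TYPE('n) q" by blast
  interpret anti_brst "mcls (\<lambda>q. cmat (Rhat q))" "mcls (\<lambda>q. cmat (matrix_inv (Rhat q)))"
    "\<lambda>a. qscal (\<lambda>q. dweight q a)" "qscal qlam" "qscal (\<lambda>q. q ^ (2 * CARD('n)))"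
    "qscal (\<lambda>q. 1 / qlam q)" "qscal (\<lambda>q. 1 / (4 + qlam q * qlam q))"
    "mcls (\<lambda>q. matT)" "mcls (\<lambda>q. matOmega)" "mcls (\<lambda>q. matL)" "mcls (\<lambda>q. matLinv)"
    "mcls (\<lambda>q. matJ :: 'n dgen free_alg ^ 'n::{finite,linorder} ^ 'n::{finite,linorder})"
    by (rule anti_brst_diff_alg[OF ex])
  note push = mcls_mult mcls_simps mcls_smult qscal_simps
  have Trq: "cls (\<lambda>q. Trq q (Y q)) = trq (mcls Y)" for Y :: "complex \<Rightarrow> 'n dgen free_alg ^ 'n::{finite,linorder} ^ 'n::{finite,linorder}"
    unfolding trq_def by (simp add: Trq_eq cls_sum qscal_def mcls_def cls_simps)
  \<comment> \<open>\<open>Qs\<close> is the class of the whole family \<open>Qstar\<close>; the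
    given \<open>q\<close> returns only at the end, through \<open>cls_eqD\<close> and
    \<open>mcls_eqD\<close>.\<close>
  have Q: "cls Qstar = Qs"
    unfolding Qs_eq Qstar_def[abs_def] Trq push ..
  have comm: "mcls (\<lambda>q. commutator_mat (Qstar q) Y) = Qs \<star> mcls (\<lambda>q. Y) - mcls (\<lambda>q. Y) ** mat Qs"
    and anticomm: "mcls (\<lambda>q. anticommutator_mat (Qstar q) Y) = Qs \<star> mcls (\<lambda>q. Y) + mcls (\<lambda>q. Y) ** mat Qs"
    for Y :: "'n dgen free_alg ^ 'n::{finite,linorder} ^ 'n::{finite,linorder}"
    unfolding Q[symmetric]
    by (simp_all add: vec_eq_iff mcls_def commutator_mat_def anticommutator_mat_def cls_simps)
  have 1: "cls Qstar = cls (\<lambda>q. scal (1 / qlam q) * (Trq q (Theta_star q) - Trq q matJ) :: 'n dgen free_alg)"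
  proof -
    have "mcls Theta_star = Theta"
      unfolding Theta_star_def[abs_def] push Theta_def Wbar_def mat_mul_eq_smul smul_mul ..
    have "cls (\<lambda>q. scal (1 / qlam q) * (Trq q (Theta_star q) - Trq q matJ) :: 'n dgen free_alg)
        = qscal (\<lambda>q. 1 / qlam q) * (cls (\<lambda>q. Trq q (Theta_star q)) - cls (\<lambda>q. Trq q matJ))"
      by (simp add: qscal_def cls_simps)
    also have "\<dots> = cls Qstar"
      unfolding Trq Q Qs_def \<open>mcls Theta_star = Theta\<close> ..
    finally show ?thesis ..
  qed
  have 2: "cls (\<lambda>q. (Qstar q)\<^sup>2) = cls (\<lambda>q. 0 :: 'n dgen free_alg)"
    using Qs_square by (simp add: power2_eq_square cls_simps flip: Q)
  have 3: "mcls (\<lambda>q. commutator_mat (Qstar q) matL) = mcls (\<lambda>q. 0 :: 'n dgen free_alg ^ 'n::{finite,linorder} ^ 'n::{finite,linorder})"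
    unfolding comm push by (rule Qs_L)
  have 4: "mcls (\<lambda>q. commutator_mat (Qstar q) matT)
      = mcls (\<lambda>q. - (q ^ (2 * CARD('n))) \<odot> (matT ** (matJ :: 'n dgen free_alg ^ 'n::{finite,linorder} ^ 'n::{finite,linorder})))"
    unfolding comm push Qs_T by (simp add: vec_eq_iff)
  have 5: "mcls (\<lambda>q. anticommutator_mat (Qstar q) matJ)
      = mcls (\<lambda>q. q ^ (2 * CARD('n)) \<odot> (matJ ** (matJ :: 'n dgen free_alg ^ 'n::{finite,linorder} ^ 'n::{finite,linorder})))"
    unfolding anticomm push by (rule Qs_J)
  have 6: "mcls (\<lambda>q. anticommutator_mat (Qstar q) matOmega)
      = mcls (\<lambda>q. q ^ (2 * CARD('n)) \<odot> (matW q ** ((1 / qlam q) \<odot> (mat 1 - matLinv)) ** matWbar q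
                        - qlam q \<odot> (matOmega ** matJ ** matJ ** (matOmega :: 'n dgen free_alg ^ 'n::{finite,linorder} ^ 'n::{finite,linorder}))))"
    unfolding anticomm matW_def matWbar_def push by (rule Qs_w)
  show ?thesis
    unfolding assms(4,5)
    using cls_eqD[OF 1 nd] cls_eqD[OF 2 nd] mcls_eqD[OF 3 nd] mcls_eqD[OF 4 nd] mcls_eqD[OF 5 nd]
      mcls_eqD[OF 6 nd]
    by blast
qed

end
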